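(* Let $R$ be a commutative ring with identity, and let $S=\{a\in R \mid a \text{ is adequate in } R\}$. If the localization $R_S=S^{-1}R$ has adequate range 1, then $R$ is an elementary divisor ring if and only if $R$ is a Hermite ring.
   Context: All rings are commutative with identity. An element $c$ of a ring $R$ is adequate if for every $a\in R$ there exist $r,s\in R$ such that (1) $c=rs$; (2) $rR+aR=R$; (3) $s'R+aR\neq R$ for each non-invertible divisor $s'$ of $s$. A ring $R$ has adequate range 1 if whenever $aR+bR=R$ with $a,b\in R$, there is $y\in R$ such that $a+by$ is adequate in $R$. The paper takes $S$ to be a multiplicatively closed set (a product of adequate elements is adequate); $R_S$ is the localization of $R$ inverting all elements of $S$. A (not necessarily square) matrix $A$ over $R$ admits a diagonal reduction if there are invertible matrices $P,Q$ such that $PAQ=(\varepsilon_{ij})$ is a diagonal matrix with $\varepsilon_{ii}$ dividing $\varepsilon_{(i+1)(i+1)}$ for each $i$. $R$ is an elementary divisor ring if every matrix over $R$ admits a diagonal reduction. $R$ is a Hermite ring if for any $a,b\in R$ there is $Q\in GL_2(R)$ such that $(a,b)Q=(c,0)$ for some $c\in R$. *)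

theory Defs
  imports "HOL-Algebra.Algebra" "Jordan_Normal_Form.Matrix"
begin

section \<open>Adequate elements\<close>

definition adequate :: "('a, 'm) ring_scheme \<Rightarrow> 'a \<Rightarrow> bool" where
  "adequate R c \<longleftrightarrow> c \<in> carrier R \<and>
     (\<forall>a\<in>carrier R. \<exists>r\<in>carrier R. \<exists>s\<in>carrier R.
        c = r \<otimes>\<^bsub>R\<^esub> s \<and>
        PIdl\<^bsub>R\<^esub> r <+>\<^bsub>R\<^esub> PIdl\<^bsub>R\<^esub> a = carrier R \<and>
        (\<forall>s'\<in>carrier R. s' divides\<^bsub>R\<^esub> s \<and> s' \<notin> Units R \<longrightarrow>
           PIdl\<^bsub>R\<^esub> s' <+>\<^bsub>R\<^esub> PIdl\<^bsub>R\<^esub> a \<noteq> carrier R))"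

definition adequate_range_1 :: "('a, 'm) ring_scheme \<Rightarrow> bool" where
  "adequate_range_1 R \<longleftrightarrow>
     (\<forall>a\<in>carrier R. \<forall>b\<in>carrier R.
        PIdl\<^bsub>R\<^esub> a <+>\<^bsub>R\<^esub> PIdl\<^bsub>R\<^esub> b = carrier R \<longrightarrow>
        (\<exists>y\<in>carrier R. adequate R (a \<oplus>\<^bsub>R\<^esub> b \<otimes>\<^bsub>R\<^esub> y)))"


section \<open>Localization\<close>

text \<open>
  The localization is defined for an arbitrary set of elements to be inverted: the denominators
  range over the submonoid generated by that set, which is the set itself if it is already
  multiplicatively closed. The localization is the zero ring if \<open>0\<close> is among the denominators.
\<close>

inductive_set mult_closure :: "('a, 'm) ring_scheme \<Rightarrow> 'a set \<Rightarrow> 'a set"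
  for R :: "('a, 'm) ring_scheme" and S :: "'a set" where
  incl: "s \<in> S \<Longrightarrow> s \<in> mult_closure R S"
| one: "\<one>\<^bsub>R\<^esub> \<in> mult_closure R S"
| mult: "s \<in> mult_closure R S \<Longrightarrow> t \<in> mult_closure R S \<Longrightarrow> s \<otimes>\<^bsub>R\<^esub> t \<in> mult_closure R S"

text \<open>The pair \<open>(a, s)\<close> stands for the fraction \<open>a / s\<close>; zero divisors among the denominators
  make the factor \<open>u\<close> necessary.\<close>

definition frac_rel :: "('a, 'm) ring_scheme \<Rightarrow> 'a set \<Rightarrow> (('a \<times> 'a) \<times> ('a \<times> 'a)) set" where
  "frac_rel R M = {((a, s), (b, t)).
     a \<in> carrier R \<and> s \<in> M \<and> b \<in> carrier R \<and> t \<in> M \<and>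
     (\<exists>u\<in>M. u \<otimes>\<^bsub>R\<^esub> (a \<otimes>\<^bsub>R\<^esub> t) = u \<otimes>\<^bsub>R\<^esub> (b \<otimes>\<^bsub>R\<^esub> s))}"

definition frac_class :: "('a, 'm) ring_scheme \<Rightarrow> 'a set \<Rightarrow> 'a \<Rightarrow> 'a \<Rightarrow> ('a \<times> 'a) set" where
  "frac_class R M a s = frac_rel R M `` {(a, s)}"

text \<open>The unions below are over all representatives of the two classes; as the operations respect
  \<open>frac_rel\<close>, every member of such a union is the same class.\<close>

definition localization :: "('a, 'm) ring_scheme \<Rightarrow> 'a set \<Rightarrow> ('a \<times> 'a) set ring" where
  "localization R S = (let M = mult_closure R S in
     \<lparr> carrier = (carrier R \<times> M) // frac_rel R M,
       monoid.mult = (\<lambda>x y. \<Union>(a, s)\<in>x. \<Union>(b, t)\<in>y. frac_class R M (a \<otimes>\<^bsub>R\<^esub> b) (s \<otimes>\<^bsub>R\<^esub> t)),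
       one = frac_class R M \<one>\<^bsub>R\<^esub> \<one>\<^bsub>R\<^esub>,
       ring.zero = frac_class R M \<zero>\<^bsub>R\<^esub> \<one>\<^bsub>R\<^esub>,
       ring.add = (\<lambda>x y. \<Union>(a, s)\<in>x. \<Union>(b, t)\<in>y.
                frac_class R M (a \<otimes>\<^bsub>R\<^esub> t \<oplus>\<^bsub>R\<^esub> b \<otimes>\<^bsub>R\<^esub> s) (s \<otimes>\<^bsub>R\<^esub> t)) \<rparr>)"


section \<open>Matrices over a ring with explicit carrier\<close>

text \<open>The type \<open>'a mat\<close> serves only as a container: its arithmetic is tied to type classes,
  whereas the entries here come from the carrier of a ring record.\<close>

definition matrices :: "('a, 'm) ring_scheme \<Rightarrow> nat \<Rightarrow> nat \<Rightarrow> 'a mat set" where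
  "matrices R m n = {A \<in> carrier_mat m n. elements_mat A \<subseteq> carrier R}"

definition mmult :: "('a, 'm) ring_scheme \<Rightarrow> 'a mat \<Rightarrow> 'a mat \<Rightarrow> 'a mat" where
  "mmult R A B = mat (dim_row A) (dim_col B)
     (\<lambda>(i, j). \<Oplus>\<^bsub>R\<^esub>k\<in>{..<dim_col A}. A $$ (i, k) \<otimes>\<^bsub>R\<^esub> B $$ (k, j))"

definition mone :: "('a, 'm) ring_scheme \<Rightarrow> nat \<Rightarrow> 'a mat" where
  "mone R n = mat n n (\<lambda>(i, j). if i = j then \<one>\<^bsub>R\<^esub> else \<zero>\<^bsub>R\<^esub>)"

definition GL :: "('a, 'm) ring_scheme \<Rightarrow> nat \<Rightarrow> 'a mat set" where
  "GL R n = {P \<in> matrices R n n.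
     \<exists>P'\<in>matrices R n n. mmult R P P' = mone R n \<and> mmult R P' P = mone R n}"

definition admits_diagonal_reduction :: "('a, 'm) ring_scheme \<Rightarrow> 'a mat \<Rightarrow> bool" where
  "admits_diagonal_reduction R A \<longleftrightarrow>
     (\<exists>P\<in>GL R (dim_row A). \<exists>Q\<in>GL R (dim_col A).
        let D = mmult R (mmult R P A) Q in
          (\<forall>i<dim_row A. \<forall>j<dim_col A. i \<noteq> j \<longrightarrow> D $$ (i, j) = \<zero>\<^bsub>R\<^esub>) \<and>
          (\<forall>i. Suc i < min (dim_row A) (dim_col A) \<longrightarrow>
             D $$ (i, i) divides\<^bsub>R\<^esub> D $$ (Suc i, Suc i)))"

definition elementary_divisor_ring :: "('a, 'm) ring_scheme \<Rightarrow> bool" where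
  "elementary_divisor_ring R \<longleftrightarrow>
     (\<forall>m n. \<forall>A\<in>matrices R m n. admits_diagonal_reduction R A)"

definition hermite_ring :: "('a, 'm) ring_scheme \<Rightarrow> bool" where
  "hermite_ring R \<longleftrightarrow>
     (\<forall>a\<in>carrier R. \<forall>b\<in>carrier R. \<exists>Q\<in>GL R 2. \<exists>c\<in>carrier R.
        mmult R (mat_of_rows_list 2 [[a, b]]) Q = mat_of_rows_list 2 [[c, \<zero>\<^bsub>R\<^esub>]])"

end

theory Submission
  imports Defs
begin

text \<open>
  An adequate element \<open>c\<close> of a Hermite ring \<open>R\<close> is stable, i.e. \<open>R / cR\<close> has stable range 1;
  divisors and products of stable elements are stable, so all denominators of \<open>R\<^sub>S\<close> are.
  Adequate range 1 makes every unimodular triangular \<open>2 \<times> 2\<close> matrix over \<open>R\<^sub>S\<close> represent a stable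
  element as \<open>p\<^sup>T A q\<close> with \<open>p\<close> unimodular; over a Hermite ring such a matrix also represents 1.
  Applied to a unimodular triangular matrix over \<open>R\<close>, this gives \<open>p\<^sup>T A q = 1\<close> over \<open>R\<^sub>S\<close>; clearing
  denominators and dividing \<open>p\<close> by the gcd of its entries, \<open>A\<close> represents over \<open>R\<close> a divisor of a
  denominator. This is stable, so \<open>A\<close> represents 1 over \<open>R\<close>, which is Kaplansky's
  criterion for a Hermite ring to be an elementary divisor ring.
\<close>

section \<open>Unimodular sets and stable elements\<close>

text \<open>Coprimality is expressed by prime ideals: a set is \<open>unimodular\<close> if no prime
  ideal contains it. In the zero ring, a possible value of the localization, the notion holds
  vacuously and the arguments still apply. The obstacle is that an element adequate in the
  localization says nothing directly about the base ring. Hence the descent is made only once the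
  value 1 has been reached in the localization: the equation then involves denominators alone, and
  these come from the base ring. Stability is the property to carry there, because what clearing
  denominators yields is known only to divide a product of adequate elements.\<close>

definition unimodular :: "('a, 'm) ring_scheme \<Rightarrow> 'a set \<Rightarrow> bool" where
  "unimodular R A \<longleftrightarrow> (\<forall>P. primeideal P R \<longrightarrow> \<not> A \<subseteq> P)"

lemma unimodularI:
  "(\<And>P. primeideal P R \<Longrightarrow> A \<subseteq> P \<Longrightarrow> False) \<Longrightarrow> unimodular R A"
  by (auto simp: unimodular_def)

lemma unimodularD: "unimodular R A \<Longrightarrow> primeideal P R \<Longrightarrow> A \<subseteq> P \<Longrightarrow> False"
  by (auto simp: unimodular_def)

text \<open>Stability of \<open>c\<close> says that \<open>R / cR\<close> has stable range 1.\<close>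

definition stable :: "('a, 'm) ring_scheme \<Rightarrow> 'a \<Rightarrow> bool" where
  "stable R c \<longleftrightarrow> c \<in> carrier R \<and>
     (\<forall>a\<in>carrier R. \<forall>b\<in>carrier R. unimodular R {a, b, c} \<longrightarrow>
        (\<exists>y\<in>carrier R. unimodular R {a \<oplus>\<^bsub>R\<^esub> b \<otimes>\<^bsub>R\<^esub> y, c}))"

section \<open>Membership in a prime ideal\<close>

context primeideal
begin

lemma one_notin: "\<one> \<notin> I"
  using I_notcarr one_imp_carrier by auto

lemma mult_mem_iff: "a \<in> carrier R \<Longrightarrow> b \<in> carrier R \<Longrightarrow> a \<otimes> b \<in> I \<longleftrightarrow> a \<in> I \<or> b \<in> I"
  using I_prime I_l_closed I_r_closed by blast

lemma add_mem_iff: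
  assumes "x \<in> I" "y \<in> carrier R"
  shows "x \<oplus> y \<in> I \<longleftrightarrow> y \<in> I"
proof
  assume *: "x \<oplus> y \<in> I"
  have "\<ominus> x \<oplus> (x \<oplus> y) \<in> I"
    using * assms by blast
  then show "y \<in> I"
    using assms Icarr by (simp add: r_neg1)
qed (use assms in auto)

lemma add_mem_iff':
  assumes "x \<in> I" "y \<in> carrier R"
  shows "y \<oplus> x \<in> I \<longleftrightarrow> y \<in> I"
  using add_mem_iff[OF assms] assms Icarr a_comm by metis

end

section \<open>Prime ideals above proper ideals, and Bezout relations\<close>

context cring
begin

lemma ex_primeideal_superset:
  assumes "ideal J R" "J \<noteq> carrier R"
  shows "\<exists>P. primeideal P R \<and> J \<subseteq> P"
proof -
  define A where "A = {I. ideal I R \<and> J \<subseteq> I \<and> I \<noteq> carrier R}"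
  have notin: "\<one> \<notin> I" if "I \<in> A" for I
    using that  ideal.one_imp_carrier unfolding A_def by blast
  have "\<exists>M\<in>A. \<forall>I\<in>A. M \<subseteq> I \<longrightarrow> I = M"
  proof (rule subset_Zorn)
    fix C assume C: "subset.chain A C"
    show "\<exists>U\<in>A. \<forall>I\<in>C. I \<subseteq> U"
    \<comment> \<open>The union of the empty chain is not an ideal, so there \<open>J\<close> itself
      serves as upper bound.\<close>
    proof (cases "C = {}")
      case True
      then show ?thesis using assms unfolding A_def by auto
    next
      case False
      have CA: "C \<subseteq> A" using C unfolding pred_on.chain_def by auto
      have "subset.chain {I. ideal I R} C"
        using C unfolding pred_on.chain_def A_def by auto
      from chain_Union_is_ideal[OF this] False have "ideal (\<Union>C) R" by simp
      moreover have "J \<subseteq> \<Union>C" using CA False unfolding A_def by blast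
      moreover have "\<Union>C \<noteq> carrier R" using notin CA by blast
      ultimately have "\<Union>C \<in> A" unfolding A_def by blast
      then show ?thesis by blast
    qed
  qed
  then obtain M where M: "M \<in> A" "\<And>I. I \<in> A \<Longrightarrow> M \<subseteq> I \<Longrightarrow> I = M" by blast
  have "maximalideal M R"
  proof (rule maximalidealI)
    show "ideal M R" "carrier R \<noteq> M" using M(1) unfolding A_def by auto
    fix I assume "ideal I R" "M \<subseteq> I" "I \<subseteq> carrier R"
    then show "I = M \<or> I = carrier R"
      using M unfolding A_def by blast
  qed
  then show ?thesis
    using M(1) maximalideal_prime unfolding A_def by blast
qed

text \<open>A proper ideal lies in a prime ideal, so a set contained in no prime cannot generate a
  proper ideal. Every Bezout relation extracted from \<open>unimodular\<close> rests on
  this.\<close>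

lemma unimodular_genideal:
  assumes "A \<subseteq> carrier R" "unimodular R A"
  shows "Idl A = carrier R"
  using assms ex_primeideal_superset[OF genideal_ideal[OF assms(1)]] genideal_self[OF assms(1)]
  unfolding unimodular_def by (metis subset_trans)

lemma PIdl_add_subset:
  assumes "a \<in> carrier R" "ideal J R"
  shows "ideal (PIdl a <+>\<^bsub>R\<^esub> J) R" "a \<in> PIdl a <+>\<^bsub>R\<^esub> J" "J \<subseteq> PIdl a <+>\<^bsub>R\<^esub> J"
proof -
  have I: "ideal (PIdl a) R" by (rule cgenideal_ideal[OF assms(1)])
  have J: "J \<subseteq> carrier R" using ideal.Icarr[OF assms(2)] by (rule subsetI)
  show "ideal (PIdl a <+>\<^bsub>R\<^esub> J) R" by (rule add_ideals[OF I assms(2)])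
  have "Idl (PIdl a \<union> J) = PIdl a <+>\<^bsub>R\<^esub> J" by (rule union_genideal[OF I assms(2)])
  moreover have "PIdl a \<union> J \<subseteq> carrier R" using J ideal.Icarr[OF I] by auto
  ultimately have "PIdl a \<union> J \<subseteq> PIdl a <+>\<^bsub>R\<^esub> J"
    using genideal_self[of "PIdl a \<union> J"] by simp
  then show "a \<in> PIdl a <+>\<^bsub>R\<^esub> J" "J \<subseteq> PIdl a <+>\<^bsub>R\<^esub> J" using cgenideal_self[OF assms(1)] by auto
qed

lemma primeideal_linear_comb:
  assumes "primeideal P R" "a \<in> P" "b \<in> P" "u \<in> carrier R" "v \<in> carrier R"
  shows "a \<otimes> u \<oplus> b \<otimes> v \<in> P"
proof -
  interpret primeideal P R by (rule assms(1))
  show ?thesis using assms by (simp add: I_r_closed)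
qed

lemma mem_PIdl_addE:
  assumes "x \<in> PIdl a <+>\<^bsub>R\<^esub> J" "a \<in> carrier R"
  obtains u j where "u \<in> carrier R" "j \<in> J" "x = a \<otimes> u \<oplus> j"
proof -
  obtain h j where h: "h \<in> PIdl a" "j \<in> J" "x = h \<oplus> j"
    using assms(1) unfolding set_add_def' by (elim UN_E singletonE)
  obtain u where u: "u \<in> carrier R" "h = u \<otimes> a"
    using h(1) unfolding cgenideal_def by (elim CollectE exE conjE)
  have "h = a \<otimes> u" unfolding u(2) by (rule m_comm[OF u(1) assms(2)])
  then show thesis using that[of u j] u h by simp
qed

lemma mem_PIdlE:
  assumes "x \<in> PIdl a" "a \<in> carrier R"
  obtains u where "u \<in> carrier R" "x = a \<otimes> u"
proof -
  obtain u where u: "u \<in> carrier R" "x = u \<otimes> a"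
    using assms(1) unfolding cgenideal_def by (elim CollectE exE conjE)
  then show thesis using that[of u] m_comm[OF u(1) assms(2)] by simp
qed

lemma PIdl_pairE:
  assumes "x \<in> PIdl a <+>\<^bsub>R\<^esub> PIdl b" "a \<in> carrier R" "b \<in> carrier R"
  obtains u v where "u \<in> carrier R" "v \<in> carrier R" "x = a \<otimes> u \<oplus> b \<otimes> v"
proof -
  obtain u j where u: "u \<in> carrier R" "j \<in> PIdl b" "x = a \<otimes> u \<oplus> j"
    by (rule mem_PIdl_addE[OF assms(1,2)])
  obtain v where "v \<in> carrier R" "j = b \<otimes> v" by (rule mem_PIdlE[OF u(2) assms(3)])
  then show thesis using that[of u v] u by simp
qed

lemma unimodular_pairI:
  assumes "a \<in> carrier R" "b \<in> carrier R" "u \<in> carrier R" "v \<in> carrier R" "a \<otimes> u \<oplus> b \<otimes> v = \<one>"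
  shows "unimodular R {a, b}"
proof (rule unimodularI)
  fix P assume P: "primeideal P R" "{a, b} \<subseteq> P"
  interpret primeideal P R by (rule P(1))
  have "\<one> \<in> P" using primeideal_linear_comb[OF P(1), of a b u v] P(2) assms by simp
  then show False using one_notin by blast
qed

text \<open>Links the ideal sums in \<open>adequate\<close> and \<open>adequate_range_1\<close> to
  the formulation by prime ideals.\<close>

lemma unimodular_pair_ideal:
  assumes "a \<in> carrier R" "b \<in> carrier R"
  shows "PIdl a <+>\<^bsub>R\<^esub> PIdl b = carrier R \<longleftrightarrow> unimodular R {a, b}"
proof
  assume "PIdl a <+>\<^bsub>R\<^esub> PIdl b = carrier R"
  then have "\<one> \<in> PIdl a <+>\<^bsub>R\<^esub> PIdl b" by simp
  then obtain u v where "u \<in> carrier R" "v \<in> carrier R" "\<one> = a \<otimes> u \<oplus> b \<otimes> v"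
    by (rule PIdl_pairE[OF _ assms])
  then show "unimodular R {a, b}"
    using unimodular_pairI[OF assms, of u v] by simp
next
  assume *: "unimodular R {a, b}"
  have I: "ideal (PIdl a <+>\<^bsub>R\<^esub> PIdl b) R" "{a, b} \<subseteq> PIdl a <+>\<^bsub>R\<^esub> PIdl b"
    using PIdl_add_subset[OF assms(1) cgenideal_ideal[OF assms(2)]] cgenideal_self[OF assms(2)] by auto
  have "Idl {a, b} \<subseteq> PIdl a <+>\<^bsub>R\<^esub> PIdl b" by (rule genideal_minimal[OF I])
  moreover have "PIdl a <+>\<^bsub>R\<^esub> PIdl b \<subseteq> carrier R" using ideal.Icarr[OF I(1)] by auto
  moreover have "Idl {a, b} = carrier R" using unimodular_genideal[of "{a, b}"] * assms by simp
  ultimately show "PIdl a <+>\<^bsub>R\<^esub> PIdl b = carrier R" by simp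
qed

lemma unimodular_pairE:
  assumes "unimodular R {a, b}" "a \<in> carrier R" "b \<in> carrier R"
  obtains u v where "u \<in> carrier R" "v \<in> carrier R" "a \<otimes> u \<oplus> b \<otimes> v = \<one>"
proof -
  have "\<one> \<in> PIdl a <+>\<^bsub>R\<^esub> PIdl b"
    using assms unimodular_pair_ideal[OF assms(2,3)] by simp
  then obtain u v where "u \<in> carrier R" "v \<in> carrier R" "\<one> = a \<otimes> u \<oplus> b \<otimes> v"
    by (rule PIdl_pairE[OF _ assms(2,3)])
  then show thesis using that[of u v] by simp
qed

lemma unimodular_tripleE:
  assumes "unimodular R {a, b, c}" "a \<in> carrier R" "b \<in> carrier R" "c \<in> carrier R"
  obtains u v w where "u \<in> carrier R" "v \<in> carrier R" "w \<in> carrier R"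
    "a \<otimes> u \<oplus> (b \<otimes> v \<oplus> c \<otimes> w) = \<one>"
proof -
  have J: "ideal (PIdl b <+>\<^bsub>R\<^esub> PIdl c) R" "{b, c} \<subseteq> PIdl b <+>\<^bsub>R\<^esub> PIdl c"
    using PIdl_add_subset[OF assms(3) cgenideal_ideal[OF assms(4)]] cgenideal_self[OF assms(4)] by auto
  have I: "ideal (PIdl a <+>\<^bsub>R\<^esub> (PIdl b <+>\<^bsub>R\<^esub> PIdl c)) R"
    "{a, b, c} \<subseteq> PIdl a <+>\<^bsub>R\<^esub> (PIdl b <+>\<^bsub>R\<^esub> PIdl c)"
    using PIdl_add_subset[OF assms(2) J(1)] J(2) by auto
  have "\<one> \<in> Idl {a, b, c}" using unimodular_genideal[of "{a, b, c}"] assms by simp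
  then have "\<one> \<in> PIdl a <+>\<^bsub>R\<^esub> (PIdl b <+>\<^bsub>R\<^esub> PIdl c)" using genideal_minimal[OF I] by blast
  then obtain u j where u: "u \<in> carrier R" "j \<in> PIdl b <+>\<^bsub>R\<^esub> PIdl c" "\<one> = a \<otimes> u \<oplus> j"
    by (rule mem_PIdl_addE[OF _ assms(2)])
  obtain v w where "v \<in> carrier R" "w \<in> carrier R" "j = b \<otimes> v \<oplus> c \<otimes> w"
    by (rule PIdl_pairE[OF u(2) assms(3,4)])
  then show thesis using that[of u v w] u by simp
qed

section \<open>Stability under divisors and products\<close>

lemma stableE:
  assumes "stable R c" "unimodular R {a, b, c}" "a \<in> carrier R" "b \<in> carrier R"
  obtains y where "y \<in> carrier R" "unimodular R {a \<oplus> b \<otimes> y, c}"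
  using assms unfolding stable_def by blast

text \<open>A row that is unimodular modulo \<open>d\<close> becomes unimodular modulo the multiple
  \<open>c\<close> once the \<open>d\<close>-term of a Bezout relation is absorbed into its second
  entry. Modulo \<open>d\<close> the absorbed term disappears again.\<close>

lemma stable_factor:
  assumes "stable R c" "d \<in> carrier R" "e \<in> carrier R" "c = d \<otimes> e"
  shows "stable R d"
  unfolding stable_def
proof (intro conjI ballI impI)
  fix a b assume c1 [simp]: "a \<in> carrier R" "b \<in> carrier R" and *: "unimodular R {a, b, d}"
  note c0 [simp] = assms(2,3)
  have c: "c \<in> carrier R" using assms(4) by simp
  obtain x z w where c2 [simp]: "x \<in> carrier R" "z \<in> carrier R" "w \<in> carrier R"
    and xzw: "a \<otimes> x \<oplus> (b \<otimes> z \<oplus> d \<otimes> w) = \<one>"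
    using unimodular_tripleE[OF *] by auto
  have "unimodular R {a, b \<otimes> z \<oplus> d \<otimes> w, c}"
  proof (rule unimodularI)
    fix P assume P: "primeideal P R" "{a, b \<otimes> z \<oplus> d \<otimes> w, c} \<subseteq> P"
    interpret primeideal P R by (rule P(1))
    have "a \<otimes> x \<in> P" using P by (simp add: I_r_closed)
    then have "\<one> \<in> P" using P xzw by (metis a_closed insert_subset)
    then show False using one_notin by blast
  qed
  then obtain y where c3 [simp]: "y \<in> carrier R" and y: "unimodular R {a \<oplus> (b \<otimes> z \<oplus> d \<otimes> w) \<otimes> y, c}"
    by (rule stableE[OF assms(1)]) auto
  have "unimodular R {a \<oplus> b \<otimes> (z \<otimes> y), d}"
  proof (rule unimodularI)
    fix P assume P: "primeideal P R" "{a \<oplus> b \<otimes> (z \<otimes> y), d} \<subseteq> P"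
    interpret primeideal P R by (rule P(1))
    have "a \<oplus> (b \<otimes> z \<oplus> d \<otimes> w) \<otimes> y = (a \<oplus> b \<otimes> (z \<otimes> y)) \<oplus> d \<otimes> (w \<otimes> y)"
      using c0 c1 c2 c3 by algebra
    moreover have "d \<otimes> (w \<otimes> y) \<in> P" "c \<in> P" using P assms(4) by (simp_all add: I_r_closed)
    ultimately show False using unimodularD[OF y P(1)] P(2) by simp
  qed
  then show "\<exists>y\<in>carrier R. unimodular R {a \<oplus> b \<otimes> y, d}" by (intro bexI[of _ "z \<otimes> y"]) auto
qed (use assms in auto)

text \<open>The first entry is corrected modulo \<open>d\<close>, then modulo \<open>e\<close>. The
  second correction is a multiple of \<open>b d\<close>, so it keeps what was achieved modulo
  \<open>d\<close>; coprimality of \<open>d\<close> and \<open>e\<close> is not assumed.\<close>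

lemma stable_mult:
  assumes "stable R d" "stable R e"
  shows "stable R (d \<otimes> e)"
  unfolding stable_def
proof (intro conjI ballI impI)
  have c1 [simp]: "d \<in> carrier R" "e \<in> carrier R" using assms unfolding stable_def by auto
  show "d \<otimes> e \<in> carrier R" by simp
  fix a b assume c2 [simp]: "a \<in> carrier R" "b \<in> carrier R" and *: "unimodular R {a, b, d \<otimes> e}"
  have "unimodular R {a, b, d}"
  proof (rule unimodularI)
    fix P assume P: "primeideal P R" "{a, b, d} \<subseteq> P"
    interpret primeideal P R by (rule P(1))
    show False using unimodularD[OF * P(1)] P(2) by (simp add: mult_mem_iff)
  qed
  then obtain y where c3 [simp]: "y \<in> carrier R" and y: "unimodular R {a \<oplus> b \<otimes> y, d}"
    by (rule stableE[OF assms(1)]) auto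
  \<comment> \<open>A prime containing all three cannot contain \<open>d\<close> by the choice of
    \<open>y\<close>, so it contains \<open>b\<close>, hence \<open>a\<close>, against the
    hypothesis.\<close>
  have "unimodular R {a \<oplus> b \<otimes> y, b \<otimes> d, e}"
  proof (rule unimodularI)
    fix P assume P: "primeideal P R" "{a \<oplus> b \<otimes> y, b \<otimes> d, e} \<subseteq> P"
    interpret primeideal P R by (rule P(1))
    have d: "d \<notin> P" using unimodularD[OF y P(1)] P(2) by auto
    then have b: "b \<in> P" using P(2) by (simp add: mult_mem_iff)
    then have "a \<in> P" using P(2) by (simp add: add_mem_iff' I_r_closed)
    then show False using unimodularD[OF * P(1)] P(2) b by (simp add: mult_mem_iff)
  qed
  then obtain t where c4 [simp]: "t \<in> carrier R" and t: "unimodular R {a \<oplus> b \<otimes> y \<oplus> b \<otimes> d \<otimes> t, e}"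
    by (rule stableE[OF assms(2)]) auto
  have eq: "a \<oplus> b \<otimes> (y \<oplus> d \<otimes> t) = a \<oplus> b \<otimes> y \<oplus> b \<otimes> d \<otimes> t" using c1 c2 c3 c4 by algebra
  have "unimodular R {a \<oplus> b \<otimes> (y \<oplus> d \<otimes> t), d \<otimes> e}"
  proof (rule unimodularI)
    fix P assume P: "primeideal P R" "{a \<oplus> b \<otimes> (y \<oplus> d \<otimes> t), d \<otimes> e} \<subseteq> P"
    interpret primeideal P R by (rule P(1))
    have "e \<notin> P" using unimodularD[OF t P(1)] P(2) unfolding eq by auto
    then have d: "d \<in> P" using P(2) by (simp add: mult_mem_iff)
    have "a \<oplus> b \<otimes> y \<in> P"
      using P(2) d unfolding eq by (simp add: add_mem_iff' mult_mem_iff)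
    then show False using unimodularD[OF y P(1)] d by simp
  qed
  then show "\<exists>y\<in>carrier R. unimodular R {a \<oplus> b \<otimes> y, d \<otimes> e}" by (intro bexI[of _ "y \<oplus> d \<otimes> t"]) auto
qed

lemma stable_one: "stable R \<one>"
  unfolding stable_def
proof (intro conjI ballI impI)
  fix a b assume c1 [simp]: "a \<in> carrier R" "b \<in> carrier R"
  have "unimodular R {a \<oplus> b \<otimes> \<zero>, \<one>}"
    by (rule unimodularI) (simp add: primeideal.one_notin)
  then show "\<exists>y\<in>carrier R. unimodular R {a \<oplus> b \<otimes> y, \<one>}" by (intro bexI[of _ "\<zero>"]) simp_all
qed simp

end

section \<open>Hermite rings\<close>

text \<open>The elementwise content of \<open>hermite_ring\<close>: a common divisor with unimodular
  cofactors. In this form it passes to the localization by a computation with fractions.\<close>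

locale hermite_cring = cring +
  assumes gcd_factors: "a \<in> carrier R \<Longrightarrow> b \<in> carrier R \<Longrightarrow>
    \<exists>g\<in>carrier R. \<exists>a'\<in>carrier R. \<exists>b'\<in>carrier R. a = g \<otimes> a' \<and> b = g \<otimes> b' \<and> unimodular R {a', b'}"
begin

lemma gcdE:
  assumes "a \<in> carrier R" "b \<in> carrier R"
  obtains g a' b' u v where "g \<in> carrier R" "a' \<in> carrier R" "b' \<in> carrier R"
    "u \<in> carrier R" "v \<in> carrier R" "a = g \<otimes> a'" "b = g \<otimes> b'" "a' \<otimes> u \<oplus> b' \<otimes> v = \<one>"
    "unimodular R {a', b'}"
proof -
  obtain g a' b' where g: "g \<in> carrier R" "a' \<in> carrier R" "b' \<in> carrier R"
    "a = g \<otimes> a'" "b = g \<otimes> b'" "unimodular R {a', b'}"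
    using gcd_factors[OF assms] by blast
  show thesis by (rule unimodular_pairE[OF g(6,2,3)]) (rule that[OF g(1-3) _ _ g(4,5) _ g(6)])
qed

text \<open>Take \<open>c = r s\<close> as provided by adequacy for \<open>a\<close>; then
  \<open>y = r\<close> works. A prime containing \<open>c\<close> and \<open>a + b r\<close> cannot
  contain the part \<open>r\<close> coprime to \<open>a\<close>, so it contains \<open>s\<close>,
  and the condition on the divisors of \<open>s\<close> leads to a contradiction.\<close>

lemma adequate_imp_stable:
  assumes "adequate R c"
  shows "stable R c"
  unfolding stable_def
proof (intro conjI ballI impI)
  show c: "c \<in> carrier R" using assms unfolding adequate_def by auto
  fix a b assume c1 [simp]: "a \<in> carrier R" "b \<in> carrier R" and *: "unimodular R {a, b, c}"
  obtain r s where c2 [simp]: "r \<in> carrier R" "s \<in> carrier R" and rs: "c = r \<otimes> s"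
    and "PIdl r <+>\<^bsub>R\<^esub> PIdl a = carrier R"
    and s': "\<forall>s'\<in>carrier R. s' divides s \<and> s' \<notin> Units R \<longrightarrow> PIdl s' <+>\<^bsub>R\<^esub> PIdl a \<noteq> carrier R"
    using bspec[OF conjunct2[OF assms[unfolded adequate_def]] c1(1)] by (elim bexE conjE)
  then have ra: "unimodular R {r, a}" using unimodular_pair_ideal by simp
  have "unimodular R {a \<oplus> b \<otimes> r, c}"
  proof (rule unimodularI)
    fix P assume P: "primeideal P R" "{a \<oplus> b \<otimes> r, c} \<subseteq> P"
    interpret P: primeideal P R by (rule P(1))
    have "r \<notin> P"
    proof
      assume r: "r \<in> P"
      then have "a \<in> P" using P(2) by (simp add: P.add_mem_iff' P.mult_mem_iff)
      then show False using unimodularD[OF ra P(1)] r by simp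
    qed
    then have sP: "s \<in> P" using P(2) rs by (simp add: P.mult_mem_iff)
    have "a \<oplus> b \<otimes> r \<in> carrier R" by simp
    \<comment> \<open>That condition speaks of divisors, not of prime ideals. The gcd of
      \<open>s\<close> and \<open>a + b r\<close> is a divisor of \<open>s\<close> that stays in
      \<open>P\<close>, since its two cofactors cannot both lie in \<open>P\<close>.\<close>
    from gcd_factors[OF \<open>s \<in> carrier R\<close> this] obtain g s1 d1 where
      c3 [simp]: "g \<in> carrier R" "s1 \<in> carrier R" "d1 \<in> carrier R" and
      g: "s = g \<otimes> s1" "a \<oplus> b \<otimes> r = g \<otimes> d1" "unimodular R {s1, d1}" by blast
    have "g \<in> P"
      using sP P(2) unimodularD[OF g(3) P(1)] unfolding g by (auto simp add: P.mult_mem_iff)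
    then have "g \<notin> Units R"
      using P.one_notin P.I_r_closed[of g "inv g"] Units_r_inv[of g] Units_inv_closed[of g] by auto
    moreover have "g divides s" using g by (auto simp: factor_def)
    ultimately have "\<not> unimodular R {g, a}" using s' unimodular_pair_ideal by simp
    \<comment> \<open>\<open>Q\<close> may differ from \<open>P\<close>: it contains
      \<open>g\<close> and \<open>a\<close>, hence \<open>c\<close> and \<open>b r\<close>, but not
      \<open>r\<close>; so it contains \<open>a\<close>, \<open>b\<close> and
      \<open>c\<close>.\<close>
    then obtain Q where Q: "primeideal Q R" "g \<in> Q" "a \<in> Q" unfolding unimodular_def by auto
    interpret Q: primeideal Q R by (rule Q(1))
    have "c \<in> Q" using Q rs g(1) by (simp add: Q.mult_mem_iff)
    moreover have "a \<oplus> b \<otimes> r \<in> Q" unfolding g(2) using Q by (simp add: Q.mult_mem_iff)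
    then have "b \<otimes> r \<in> Q" using Q by (simp add: Q.add_mem_iff)
    moreover have "r \<notin> Q" using unimodularD[OF ra Q(1)] Q by auto
    ultimately show False using unimodularD[OF * Q(1)] Q by (simp add: Q.mult_mem_iff)
  qed
  then show "\<exists>y\<in>carrier R. unimodular R {a \<oplus> b \<otimes> y, c}" by (intro bexI[of _ r]) auto
qed

lemma mult_closure_stable:
  assumes "\<And>s. s \<in> S \<Longrightarrow> adequate R s" "m \<in> mult_closure R S"
  shows "stable R m"
  using assms(2) by induction (auto intro: assms(1) adequate_imp_stable stable_one stable_mult)

end

section \<open>Two-by-two matrices\<close>

text \<open>The value p^T A q for the matrix \<open>A\<close> with rows \<open>(a, b)\<close> and
  \<open>(c, d)\<close>.\<close>

definition bform ::
  "('a, 'm) ring_scheme \<Rightarrow> 'a \<Rightarrow> 'a \<Rightarrow> 'a \<Rightarrow> 'a \<Rightarrow> 'a \<Rightarrow> 'a \<Rightarrow> 'a \<Rightarrow> 'a \<Rightarrow> 'a" where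
  "bform R a b c d p1 p2 q1 q2 =
     p1 \<otimes>\<^bsub>R\<^esub> (a \<otimes>\<^bsub>R\<^esub> q1 \<oplus>\<^bsub>R\<^esub> b \<otimes>\<^bsub>R\<^esub> q2) \<oplus>\<^bsub>R\<^esub> p2 \<otimes>\<^bsub>R\<^esub> (c \<otimes>\<^bsub>R\<^esub> q1 \<oplus>\<^bsub>R\<^esub> d \<otimes>\<^bsub>R\<^esub> q2)"

definition represents_one :: "('a, 'm) ring_scheme \<Rightarrow> 'a \<Rightarrow> 'a \<Rightarrow> 'a \<Rightarrow> 'a \<Rightarrow> bool" where
  "represents_one R a b c d \<longleftrightarrow>
     (\<exists>p1\<in>carrier R. \<exists>p2\<in>carrier R. \<exists>q1\<in>carrier R. \<exists>q2\<in>carrier R. bform R a b c d p1 p2 q1 q2 = \<one>\<^bsub>R\<^esub>)"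

lemma (in cring) bform_closed [simp]:
  "\<lbrakk>a \<in> carrier R; b \<in> carrier R; c \<in> carrier R; d \<in> carrier R; p1 \<in> carrier R; p2 \<in> carrier R;
    q1 \<in> carrier R; q2 \<in> carrier R\<rbrakk> \<Longrightarrow> bform R a b c d p1 p2 q1 q2 \<in> carrier R"
  by (simp add: bform_def)

context hermite_cring
begin

text \<open>Completing \<open>p\<close> to an invertible matrix and clearing the first row by column operations
  turns the matrix into one with rows \<open>(h, 0)\<close> and \<open>(z, z')\<close>, where \<open>h\<close> is stable
  as a divisor of the represented element; so \<open>z + z' y\<close> and \<open>h\<close> are coprime for some \<open>y\<close>.\<close>

lemma represents_one_if_stable:
  assumes c1 [simp]: "a \<in> carrier R" "b \<in> carrier R" "c \<in> carrier R" "d \<in> carrier R"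
    and abcd: "unimodular R {a, b, c, d}"
    and c2 [simp]: "p1 \<in> carrier R" "p2 \<in> carrier R" "q1 \<in> carrier R" "q2 \<in> carrier R"
    and p: "unimodular R {p1, p2}"
    and stab: "stable R (bform R a b c d p1 p2 q1 q2)"
  shows "represents_one R a b c d"
proof -
  obtain s t where c3 [simp]: "s \<in> carrier R" "t \<in> carrier R" and st: "p1 \<otimes> s \<oplus> p2 \<otimes> t = \<one>"
    using unimodular_pairE[OF p] by auto
  define w1 w2 where "w1 = p1 \<otimes> a \<oplus> p2 \<otimes> c" and "w2 = p1 \<otimes> b \<oplus> p2 \<otimes> d"
  have c4 [simp]: "w1 \<in> carrier R" "w2 \<in> carrier R" by (simp_all add: w1_def w2_def)
  obtain h x1 x2 u v where c5 [simp]: "h \<in> carrier R" "x1 \<in> carrier R" "x2 \<in> carrier R"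
      "u \<in> carrier R" "v \<in> carrier R"
    and w: "w1 = h \<otimes> x1" "w2 = h \<otimes> x2" and uv: "x1 \<otimes> u \<oplus> x2 \<otimes> v = \<one>"
    by (rule gcdE[OF c4])
  have "bform R a b c d p1 p2 q1 q2 = w1 \<otimes> q1 \<oplus> w2 \<otimes> q2"
    using c1 c2 c3 c4 c5 unfolding bform_def w1_def w2_def by algebra
  also have "\<dots> = h \<otimes> (x1 \<otimes> q1 \<oplus> x2 \<otimes> q2)" using c1 c2 c3 c4 c5 unfolding w by algebra
  finally have h: "stable R h" by (rule stable_factor[OF stab c5(1), rotated]) simp
  \<comment> \<open>The row \<open>(- t, s)\<close> completes \<open>p\<close> to a matrix of
    determinant \<open>p1 s + p2 t = 1\<close>; \<open>z1\<close>, \<open>z2\<close> form the second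
    row of the product with the given matrix.\<close>
  define z1 z2 where "z1 = s \<otimes> c \<ominus> t \<otimes> a" and "z2 = s \<otimes> d \<ominus> t \<otimes> b"
  have c6 [simp]: "z1 \<in> carrier R" "z2 \<in> carrier R" by (simp_all add: z1_def z2_def)
  \<comment> \<open>The column operation with columns \<open>(u, v)\<close> and
    \<open>(- x2, x1)\<close> takes \<open>(w1, w2)\<close> to \<open>(h, 0)\<close> and
    \<open>(z1, z2)\<close> to \<open>(z, z')\<close>.\<close>
  define z z' where "z = z1 \<otimes> u \<oplus> z2 \<otimes> v" and "z' = z2 \<otimes> x1 \<ominus> z1 \<otimes> x2"
  have c7 [simp]: "z \<in> carrier R" "z' \<in> carrier R" by (simp_all add: z_def z'_def)
  have "unimodular R {z, z', h}"
  proof (rule unimodularI)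
    fix P assume P: "primeideal P R" "{z, z', h} \<subseteq> P"
    interpret P: primeideal P R by (rule P(1))
    have wP: "w1 \<in> P" "w2 \<in> P" using P(2) unfolding w by (simp_all add: P.I_r_closed)
    \<comment> \<open>The column operation and then the row operation are undone: a prime containing
      the transformed entries contains the original four.\<close>
    have "z \<otimes> x1 \<oplus> z' \<otimes> (\<ominus> v) = z1 \<otimes> (x1 \<otimes> u \<oplus> x2 \<otimes> v)"
      using c1 c2 c3 c4 c5 c6 c7 unfolding z_def z'_def by algebra
    then have z1P: "z1 \<in> P" using primeideal_linear_comb[OF P(1), of z z' x1 "\<ominus> v"] P(2) uv by simp
    have "z \<otimes> x2 \<oplus> z' \<otimes> u = z2 \<otimes> (x1 \<otimes> u \<oplus> x2 \<otimes> v)"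
      using c1 c2 c3 c4 c5 c6 c7 unfolding z_def z'_def by algebra
    then have z2P: "z2 \<in> P" using primeideal_linear_comb[OF P(1), of z z' x2 u] P(2) uv by simp
    have "w1 \<otimes> s \<oplus> z1 \<otimes> (\<ominus> p2) = a \<otimes> (p1 \<otimes> s \<oplus> p2 \<otimes> t)"
      using c1 c2 c3 c4 c5 c6 c7 unfolding w1_def z1_def by algebra
    then have "a \<in> P" using primeideal_linear_comb[OF P(1) wP(1) z1P, of s "\<ominus> p2"] st by simp
    moreover have "w1 \<otimes> t \<oplus> z1 \<otimes> p1 = c \<otimes> (p1 \<otimes> s \<oplus> p2 \<otimes> t)"
      using c1 c2 c3 c4 c5 c6 c7 unfolding w1_def z1_def by algebra
    then have "c \<in> P" using primeideal_linear_comb[OF P(1) wP(1) z1P, of t p1] st by simp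
    moreover have "w2 \<otimes> s \<oplus> z2 \<otimes> (\<ominus> p2) = b \<otimes> (p1 \<otimes> s \<oplus> p2 \<otimes> t)"
      using c1 c2 c3 c4 c5 c6 c7 unfolding w2_def z2_def by algebra
    then have "b \<in> P" using primeideal_linear_comb[OF P(1) wP(2) z2P, of s "\<ominus> p2"] st by simp
    moreover have "w2 \<otimes> t \<oplus> z2 \<otimes> p1 = d \<otimes> (p1 \<otimes> s \<oplus> p2 \<otimes> t)"
      using c1 c2 c3 c4 c5 c6 c7 unfolding w2_def z2_def by algebra
    then have "d \<in> P" using primeideal_linear_comb[OF P(1) wP(2) z2P, of t p1] st by simp
    ultimately show False using unimodularD[OF abcd P(1)] by simp
  qed
  from stableE[OF h this] obtain y where c8 [simp]: "y \<in> carrier R"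
    and "unimodular R {z \<oplus> z' \<otimes> y, h}" by auto
  then obtain m n where c9 [simp]: "m \<in> carrier R" "n \<in> carrier R"
    and mn: "(z \<oplus> z' \<otimes> y) \<otimes> m \<oplus> h \<otimes> n = \<one>" using unimodular_pairE[of "z \<oplus> z' \<otimes> y" h] by auto
  \<comment> \<open>The column vector \<open>(1, y)\<close> of the transformed matrix in the old
    coordinates; the two rows evaluate on it to \<open>h\<close> and
    \<open>z + z' y\<close>.\<close>
  have e1: "w1 \<otimes> (u \<ominus> x2 \<otimes> y) \<oplus> w2 \<otimes> (v \<oplus> x1 \<otimes> y) = h \<otimes> (x1 \<otimes> u \<oplus> x2 \<otimes> v)"
    using c1 c2 c3 c4 c5 c6 c7 c8 c9 unfolding w by algebra
  have e2: "z1 \<otimes> (u \<ominus> x2 \<otimes> y) \<oplus> z2 \<otimes> (v \<oplus> x1 \<otimes> y) = z \<oplus> z' \<otimes> y"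
    using c1 c2 c3 c4 c5 c6 c7 c8 c9 unfolding z_def z'_def by algebra
  \<comment> \<open>The row vector is \<open>n\<close> times \<open>p\<close> plus \<open>m\<close>
    times the completing row \<open>(- t, s)\<close>, so the form combines the two row values with
    the Bezout coefficients \<open>n\<close> and \<open>m\<close>.\<close>
  have expand: "bform R a b c d (p1 \<otimes> n \<ominus> t \<otimes> m) (p2 \<otimes> n \<oplus> s \<otimes> m) r1 r2 =
      (z1 \<otimes> r1 \<oplus> z2 \<otimes> r2) \<otimes> m \<oplus> (w1 \<otimes> r1 \<oplus> w2 \<otimes> r2) \<otimes> n"
    if "r1 \<in> carrier R" "r2 \<in> carrier R" for r1 r2
    using that c1 c2 c3 c4 c5 c6 c7 c8 c9 unfolding bform_def w1_def w2_def z1_def z2_def by algebra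
  have "bform R a b c d (p1 \<otimes> n \<ominus> t \<otimes> m) (p2 \<otimes> n \<oplus> s \<otimes> m) (u \<ominus> x2 \<otimes> y) (v \<oplus> x1 \<otimes> y) = \<one>"
    by (subst expand) (simp_all add: e1 e2 uv mn)
  then show ?thesis unfolding represents_one_def
    by (intro bexI[of _ "p1 \<otimes> n \<ominus> t \<otimes> m"] bexI[of _ "p2 \<otimes> n \<oplus> s \<otimes> m"]
        bexI[of _ "u \<ominus> x2 \<otimes> y"] bexI[of _ "v \<oplus> x1 \<otimes> y"]) simp_all
qed

text \<open>For \<open>p = (p1, 1)\<close> and \<open>q = (1, q2)\<close> the form is
  \<open>b + a p1 + c q2\<close>, so it takes every value in \<open>b\<close> plus the ideal of
  \<open>a\<close> and \<open>c\<close>. That ideal is generated by the gcd \<open>e\<close>, and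
  \<open>b\<close>, \<open>e\<close> are coprime, so adequate range 1 supplies an adequate
  value.\<close>

lemma adequate_range_1_represents_one:
  assumes "adequate_range_1 R" and c1 [simp]: "a \<in> carrier R" "b \<in> carrier R" "c \<in> carrier R"
    and abc: "unimodular R {a, b, c}"
  shows "represents_one R a \<zero> b c"
proof -
  obtain e a' c' x y where c2 [simp]: "e \<in> carrier R" "a' \<in> carrier R" "c' \<in> carrier R"
      "x \<in> carrier R" "y \<in> carrier R"
    and e: "a = e \<otimes> a'" "c = e \<otimes> c'" and xy: "a' \<otimes> x \<oplus> c' \<otimes> y = \<one>"
    by (rule gcdE[OF c1(1,3)])
  have "unimodular R {b, e}"
  proof (rule unimodularI)
    fix P assume P: "primeideal P R" "{b, e} \<subseteq> P"
    interpret P: primeideal P R by (rule P(1))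
    show False using unimodularD[OF abc P(1)] P(2) unfolding e by (simp add: P.I_r_closed)
  qed
  then obtain z where c3 [simp]: "z \<in> carrier R" and z: "adequate R (b \<oplus> e \<otimes> z)"
    using bspec[OF bspec[OF assms(1)[unfolded adequate_range_1_def] c1(2)] c2(1)]
      unimodular_pair_ideal[OF c1(2) c2(1)] by auto
  have "bform R a \<zero> b c (x \<otimes> z) \<one> \<one> (y \<otimes> z) = b \<oplus> e \<otimes> (a' \<otimes> x \<oplus> c' \<otimes> y) \<otimes> z"
    using c1 c2 c3 unfolding bform_def e by algebra
  then have "bform R a \<zero> b c (x \<otimes> z) \<one> \<one> (y \<otimes> z) = b \<oplus> e \<otimes> z" using xy by simp
  then have "stable R (bform R a \<zero> b c (x \<otimes> z) \<one> \<one> (y \<otimes> z))"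
    using adequate_imp_stable[OF z] by simp
  moreover have "unimodular R {x \<otimes> z, \<one>}"
    by (rule unimodularI) (simp add: primeideal.one_notin)
  moreover have "unimodular R {a, \<zero>, b, c}"
    using abc unfolding unimodular_def by auto
  ultimately show ?thesis
    using represents_one_if_stable[of a \<zero> b c "x \<otimes> z" \<one> \<one> "y \<otimes> z"] by simp
qed

lemma gcd_tripleE:
  assumes "a \<in> carrier R" "b \<in> carrier R" "c \<in> carrier R"
  obtains g a' b' c' where "g \<in> carrier R" "a' \<in> carrier R" "b' \<in> carrier R" "c' \<in> carrier R"
    "a = g \<otimes> a'" "b = g \<otimes> b'" "c = g \<otimes> c'" "unimodular R {a', b', c'}"
proof -
  obtain h a1 b1 where h: "h \<in> carrier R" "a1 \<in> carrier R" "b1 \<in> carrier R"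
    "a = h \<otimes> a1" "b = h \<otimes> b1" "unimodular R {a1, b1}" by (rule gcdE[OF assms(1,2)])
  obtain g h' c' where g: "g \<in> carrier R" "h' \<in> carrier R" "c' \<in> carrier R"
    "h = g \<otimes> h'" "c = g \<otimes> c'" "unimodular R {h', c'}" by (rule gcdE[OF h(1) assms(3)])
  have "unimodular R {h' \<otimes> a1, h' \<otimes> b1, c'}"
  proof (rule unimodularI)
    fix P assume P: "primeideal P R" "{h' \<otimes> a1, h' \<otimes> b1, c'} \<subseteq> P"
    interpret P: primeideal P R by (rule P(1))
    show False
      using unimodularD[OF g(6) P(1)] unimodularD[OF h(6) P(1)] P(2) h(2,3) g(2)
      by (auto simp: P.mult_mem_iff)
  qed
  moreover have "a = g \<otimes> (h' \<otimes> a1)" "b = g \<otimes> (h' \<otimes> b1)"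
    unfolding h(4,5) g(4) by (rule m_assoc[OF g(1,2) h(2)], rule m_assoc[OF g(1,2) h(3)])
  ultimately show thesis
    by (intro that[OF g(1) m_closed[OF g(2) h(2)] m_closed[OF g(2) h(3)] g(3) _ _ g(5)])
qed

end

text \<open>Kaplansky's condition: regrouped, the equation says that \<open>p1 a + p2 b\<close> and
  \<open>p2 c\<close> are coprime, with \<open>q1\<close>, \<open>q2\<close> as Bezout coefficients.
  The diagonal reduction is built on this and the Hermite property alone.\<close>

locale represents_cring = hermite_cring +
  assumes represents: "\<lbrakk>a \<in> carrier R; b \<in> carrier R; c \<in> carrier R; unimodular R {a, b, c}\<rbrakk> \<Longrightarrow>
      represents_one R a \<zero> b c"
begin

text \<open>A column operation makes the matrix triangular, and division by the gcd \<open>g\<close>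
  of the remaining entries makes it unimodular; a representation of 1 then becomes one of
  \<open>g\<close>. Unimodular \<open>p\<close> and \<open>q\<close> can be completed to invertible
  matrices, which moves \<open>g\<close> to a pivot position.\<close>

lemma represents_gcd:
  assumes c1: "a \<in> carrier R" "b \<in> carrier R" "c \<in> carrier R" "d \<in> carrier R"
  shows "\<exists>p1\<in>carrier R. \<exists>p2\<in>carrier R. \<exists>q1\<in>carrier R. \<exists>q2\<in>carrier R.
    unimodular R {p1, p2} \<and> unimodular R {q1, q2} \<and>
    (\<forall>x\<in>{a, b, c, d}. bform R a b c d p1 p2 q1 q2 divides x)"
proof -
  obtain h x1 x2 u v where c2: "h \<in> carrier R" "x1 \<in> carrier R" "x2 \<in> carrier R"
      "u \<in> carrier R" "v \<in> carrier R"
    and ab: "a = h \<otimes> x1" "b = h \<otimes> x2" and uv: "x1 \<otimes> u \<oplus> x2 \<otimes> v = \<one>"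
    by (rule gcdE[OF c1(1,2)])
  define z1 z2 where "z1 = c \<otimes> u \<oplus> d \<otimes> v" and "z2 = d \<otimes> x1 \<ominus> c \<otimes> x2"
  have c3: "z1 \<in> carrier R" "z2 \<in> carrier R" using c1 c2 by (simp_all add: z1_def z2_def)
  obtain g h' y1 y2 where c4: "g \<in> carrier R" "h' \<in> carrier R" "y1 \<in> carrier R" "y2 \<in> carrier R"
    and g: "h = g \<otimes> h'" "z1 = g \<otimes> y1" "z2 = g \<otimes> y2" and hy: "unimodular R {h', y1, y2}"
    by (rule gcd_tripleE[OF c2(1) c3])
  obtain p1 p2 r1 r2 where c5: "p1 \<in> carrier R" "p2 \<in> carrier R" "r1 \<in> carrier R" "r2 \<in> carrier R"
    and one: "bform R h' \<zero> y1 y2 p1 p2 r1 r2 = \<one>"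
    using represents[OF c4(2-4) hy] unfolding represents_one_def by (elim bexE)
  \<comment> \<open>The column operation with columns \<open>(u, v)\<close> and
    \<open>(- x2, x1)\<close> carries the coordinates \<open>r1\<close>, \<open>r2\<close> back to
    the original matrix.\<close>
  define q1 q2 where "q1 = u \<otimes> r1 \<ominus> x2 \<otimes> r2" and "q2 = v \<otimes> r1 \<oplus> x1 \<otimes> r2"
  have c6: "q1 \<in> carrier R" "q2 \<in> carrier R" using c2 c5 by (simp_all add: q1_def q2_def)
  \<comment> \<open>A representation of 1 is a Bezout relation for \<open>p1\<close>,
    \<open>p2\<close> and, regrouped, also for \<open>r1\<close>, \<open>r2\<close>.\<close>
  have "p1 \<otimes> (h' \<otimes> r1) \<oplus> p2 \<otimes> (y1 \<otimes> r1 \<oplus> y2 \<otimes> r2) = bform R h' \<zero> y1 y2 p1 p2 r1 r2"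
    using c4 c5 unfolding bform_def by algebra
  then have p: "unimodular R {p1, p2}"
    using unimodular_pairI[OF c5(1,2), of "h' \<otimes> r1" "y1 \<otimes> r1 \<oplus> y2 \<otimes> r2"] c4 c5 one by simp
  have "r1 \<otimes> (p1 \<otimes> h' \<oplus> p2 \<otimes> y1) \<oplus> r2 \<otimes> (p2 \<otimes> y2) = bform R h' \<zero> y1 y2 p1 p2 r1 r2"
    using c4 c5 unfolding bform_def by algebra
  then have r: "unimodular R {r1, r2}"
    using unimodular_pairI[OF c5(3,4), of "p1 \<otimes> h' \<oplus> p2 \<otimes> y1" "p2 \<otimes> y2"] c4 c5 one by simp
  have q: "unimodular R {q1, q2}"
  proof (rule unimodularI)
    fix P assume P: "primeideal P R" "{q1, q2} \<subseteq> P"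
    have "q1 \<otimes> x1 \<oplus> q2 \<otimes> x2 = (x1 \<otimes> u \<oplus> x2 \<otimes> v) \<otimes> r1"
      using c2 c5 unfolding q1_def q2_def by algebra
    then have "r1 \<in> P" using primeideal_linear_comb[OF P(1), of q1 q2 x1 x2] P(2) c2 c5 uv by simp
    moreover have "q2 \<otimes> u \<oplus> q1 \<otimes> (\<ominus> v) = (x1 \<otimes> u \<oplus> x2 \<otimes> v) \<otimes> r2"
      using c2 c5 unfolding q1_def q2_def by algebra
    then have "r2 \<in> P" using primeideal_linear_comb[OF P(1), of q2 q1 u "\<ominus> v"] P(2) c2 c5 uv by simp
    ultimately show False using unimodularD[OF r P(1)] by simp
  qed
  have 1: "a \<otimes> q1 \<oplus> b \<otimes> q2 = h \<otimes> r1 \<otimes> (x1 \<otimes> u \<oplus> x2 \<otimes> v)"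
    using c2 c5 unfolding ab q1_def q2_def by algebra
  have 2: "c \<otimes> q1 \<oplus> d \<otimes> q2 = z1 \<otimes> r1 \<oplus> z2 \<otimes> r2"
    using c1 c2 c5 unfolding z1_def z2_def q1_def q2_def by algebra
  have "bform R a b c d p1 p2 q1 q2 = p1 \<otimes> (h \<otimes> r1) \<oplus> p2 \<otimes> (z1 \<otimes> r1 \<oplus> z2 \<otimes> r2)"
    unfolding bform_def 1 2 uv using c2 c5 by simp
  also have "\<dots> = g \<otimes> bform R h' \<zero> y1 y2 p1 p2 r1 r2"
    using c4 c5 unfolding bform_def g by algebra
  finally have bg: "bform R a b c d p1 p2 q1 q2 = g" using one c4 by simp
  \<comment> \<open>The inverse column operation expresses \<open>c\<close> and \<open>d\<close> by
    \<open>z1\<close> and \<open>z2\<close>, which are multiples of \<open>g\<close>.\<close>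
  have c: "c = z1 \<otimes> x1 \<ominus> z2 \<otimes> v"
  proof -
    have "z1 \<otimes> x1 \<ominus> z2 \<otimes> v = c \<otimes> (x1 \<otimes> u \<oplus> x2 \<otimes> v)"
      using c1 c2 unfolding z1_def z2_def by algebra
    then show ?thesis using uv c1 by simp
  qed
  have d: "d = z1 \<otimes> x2 \<oplus> z2 \<otimes> u"
  proof -
    have "z1 \<otimes> x2 \<oplus> z2 \<otimes> u = d \<otimes> (x1 \<otimes> u \<oplus> x2 \<otimes> v)"
      using c1 c2 unfolding z1_def z2_def by algebra
    then show ?thesis using uv c1 by simp
  qed
  have "a = g \<otimes> (h' \<otimes> x1)" "b = g \<otimes> (h' \<otimes> x2)" using ab g(1) c2 c4 m_assoc by simp_all
  moreover have "c = g \<otimes> (y1 \<otimes> x1 \<ominus> y2 \<otimes> v)"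
  proof -
    have "g \<otimes> y1 \<otimes> x1 \<ominus> g \<otimes> y2 \<otimes> v = g \<otimes> (y1 \<otimes> x1 \<ominus> y2 \<otimes> v)" using c2 c4 by algebra
    then show ?thesis using c g(2,3) by simp
  qed
  moreover have "d = g \<otimes> (y1 \<otimes> x2 \<oplus> y2 \<otimes> u)"
  proof -
    have "g \<otimes> y1 \<otimes> x2 \<oplus> g \<otimes> y2 \<otimes> u = g \<otimes> (y1 \<otimes> x2 \<oplus> y2 \<otimes> u)" using c2 c4 by algebra
    then show ?thesis using d g(2,3) by simp
  qed
  ultimately have "g divides a" "g divides b" "g divides c" "g divides d"
    by (elim dividesI[rotated], use c2 c4 in simp)+
  then show ?thesis
    using c5 c6 p q bg
    by (intro bexI[of _ p1] bexI[of _ p2] bexI[of _ q1] bexI[of _ q2]) simp_all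
qed

end

section \<open>Localizations\<close>

locale cring_localization = cring +
  fixes S :: "'a set"
  assumes S_subset: "S \<subseteq> carrier R"
begin

abbreviation M where "M \<equiv> mult_closure R S"

abbreviation frac where "frac a s \<equiv> frac_class R M a s"

abbreviation L where "L \<equiv> localization R S"

lemma M_closed: "s \<in> M \<Longrightarrow> s \<in> carrier R"
  by (induction rule: mult_closure.induct) (use S_subset in auto)

lemmas M_mult = mult_closure.mult[of _ R S]
lemmas M_one = mult_closure.one[of R S]

section \<open>Fractions as equivalence classes\<close>

lemma frac_rel_iff:
  "((a, s), (b, t)) \<in> frac_rel R M \<longleftrightarrow> a \<in> carrier R \<and> s \<in> M \<and> b \<in> carrier R \<and> t \<in> M \<and>
     (\<exists>u\<in>M. u \<otimes> (a \<otimes> t) = u \<otimes> (b \<otimes> s))"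
  by (simp add: frac_rel_def)

lemma frac_rel_trans:
  assumes "((a, s), (b, t)) \<in> frac_rel R M" "((b, t), (c, r)) \<in> frac_rel R M"
  shows "((a, s), (c, r)) \<in> frac_rel R M"
proof -
  from assms obtain u v where M: "s \<in> M" "t \<in> M" "r \<in> M" "u \<in> M" "v \<in> M"
    and c1: "a \<in> carrier R" "b \<in> carrier R" "c \<in> carrier R"
    and eq: "u \<otimes> (a \<otimes> t) = u \<otimes> (b \<otimes> s)" "v \<otimes> (b \<otimes> r) = v \<otimes> (c \<otimes> t)"
    unfolding frac_rel_iff by (elim conjE bexE) simp
  note c2 = M[THEN M_closed]
  \<comment> \<open>The factor \<open>t\<close>, the denominator of the middle fraction, is what
    allows both given equations to be applied.\<close>
  have "u \<otimes> v \<otimes> t \<otimes> (a \<otimes> r) = (u \<otimes> (a \<otimes> t)) \<otimes> (v \<otimes> r)" using c1 c2 by algebra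
  also have "\<dots> = (v \<otimes> (b \<otimes> r)) \<otimes> (u \<otimes> s)" unfolding eq(1) using c1 c2 by algebra
  also have "\<dots> = u \<otimes> v \<otimes> t \<otimes> (c \<otimes> s)" unfolding eq(2) using c1 c2 by algebra
  finally have "u \<otimes> v \<otimes> t \<otimes> (a \<otimes> r) = u \<otimes> v \<otimes> t \<otimes> (c \<otimes> s)" .
  moreover have "u \<otimes> v \<otimes> t \<in> M" using M M_mult by simp
  ultimately show ?thesis unfolding frac_rel_iff using M c1 by auto
qed

lemma equiv_frac_rel: "equiv (carrier R \<times> M) (frac_rel R M)"
proof (rule equivI)
  show "frac_rel R M \<subseteq> (carrier R \<times> M) \<times> (carrier R \<times> M)"
    by (auto simp: frac_rel_def)
  show "refl_on (carrier R \<times> M) (frac_rel R M)"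
    unfolding refl_on_def by (auto simp: frac_rel_iff intro!: bexI[OF _ M_one])
  show "sym (frac_rel R M)"
    by (rule symI) (auto simp: frac_rel_def intro: sym)
  show "trans (frac_rel R M)"
    by (rule transI) (auto intro: frac_rel_trans)
qed

lemma frac_eq_iff:
  assumes "a \<in> carrier R" "b \<in> carrier R" "s \<in> M" "t \<in> M"
  shows "frac a s = frac b t \<longleftrightarrow> (\<exists>u\<in>M. u \<otimes> (a \<otimes> t) = u \<otimes> (b \<otimes> s))"
  unfolding frac_class_def
  using eq_equiv_class_iff[OF equiv_frac_rel, of "(a, s)" "(b, t)"] assms by (simp add: frac_rel_iff)

lemma frac_eqI:
  assumes "a \<in> carrier R" "b \<in> carrier R" "s \<in> M" "t \<in> M" "a \<otimes> t = b \<otimes> s"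
  shows "frac a s = frac b t"
  using frac_eq_iff[OF assms(1-4)] assms(5) M_one by auto

lemma frac_mult_cong:
  assumes "((a, s), (a', s')) \<in> frac_rel R M" "((b, t), (b', t')) \<in> frac_rel R M"
  shows "frac (a \<otimes> b) (s \<otimes> t) = frac (a' \<otimes> b') (s' \<otimes> t')"
proof -
  from assms obtain u v where M: "s \<in> M" "s' \<in> M" "t \<in> M" "t' \<in> M" "u \<in> M" "v \<in> M"
    and c1: "a \<in> carrier R" "a' \<in> carrier R" "b \<in> carrier R" "b' \<in> carrier R"
    and eq: "u \<otimes> (a \<otimes> s') = u \<otimes> (a' \<otimes> s)" "v \<otimes> (b \<otimes> t') = v \<otimes> (b' \<otimes> t)"
    unfolding frac_rel_iff by (elim conjE bexE) simp
  note c2 = M[THEN M_closed]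
  have "u \<otimes> v \<otimes> (a \<otimes> b \<otimes> (s' \<otimes> t')) = (u \<otimes> (a \<otimes> s')) \<otimes> (v \<otimes> (b \<otimes> t'))" using c1 c2 by algebra
  also have "\<dots> = u \<otimes> v \<otimes> (a' \<otimes> b' \<otimes> (s \<otimes> t))" unfolding eq using c1 c2 by algebra
  finally show ?thesis using M c1 by (subst frac_eq_iff) (auto intro!: bexI[of _ "u \<otimes> v"] M_mult)
qed

lemma frac_add_cong:
  assumes "((a, s), (a', s')) \<in> frac_rel R M" "((b, t), (b', t')) \<in> frac_rel R M"
  shows "frac (a \<otimes> t \<oplus> b \<otimes> s) (s \<otimes> t) = frac (a' \<otimes> t' \<oplus> b' \<otimes> s') (s' \<otimes> t')"
proof -
  from assms obtain u v where M: "s \<in> M" "s' \<in> M" "t \<in> M" "t' \<in> M" "u \<in> M" "v \<in> M"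
    and c1: "a \<in> carrier R" "a' \<in> carrier R" "b \<in> carrier R" "b' \<in> carrier R"
    and eq: "u \<otimes> (a \<otimes> s') = u \<otimes> (a' \<otimes> s)" "v \<otimes> (b \<otimes> t') = v \<otimes> (b' \<otimes> t)"
    unfolding frac_rel_iff by (elim conjE bexE) simp
  note c2 = M[THEN M_closed]
  have "u \<otimes> v \<otimes> ((a \<otimes> t \<oplus> b \<otimes> s) \<otimes> (s' \<otimes> t')) =
      (u \<otimes> (a \<otimes> s')) \<otimes> (v \<otimes> t \<otimes> t') \<oplus> (v \<otimes> (b \<otimes> t')) \<otimes> (u \<otimes> s \<otimes> s')" using c1 c2 by algebra
  also have "\<dots> = u \<otimes> v \<otimes> ((a' \<otimes> t' \<oplus> b' \<otimes> s') \<otimes> (s \<otimes> t))" unfolding eq using c1 c2 by algebra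
  finally show ?thesis using M c1 c2
    by (subst frac_eq_iff) (auto intro!: bexI[of _ "u \<otimes> v"] M_mult)
qed

lemma frac_mult:
  assumes "a \<in> carrier R" "b \<in> carrier R" "s \<in> M" "t \<in> M"
  shows "frac a s \<otimes>\<^bsub>L\<^esub> frac b t = frac (a \<otimes> b) (s \<otimes> t)"
proof -
  have "congruent2 (frac_rel R M) (frac_rel R M) (\<lambda>(a, s) (b, t). frac (a \<otimes> b) (s \<otimes> t))"
    by (rule congruent2I', simp only: split_paired_all prod.case, rule frac_mult_cong)
  from UN_equiv_class2[OF equiv_frac_rel equiv_frac_rel this, of "(a, s)" "(b, t)"] assms
  show ?thesis
    unfolding localization_def Let_def
    by (simp add: frac_class_def[symmetric] case_prod_unfold)
qed

lemma frac_add: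
  assumes "a \<in> carrier R" "b \<in> carrier R" "s \<in> M" "t \<in> M"
  shows "frac a s \<oplus>\<^bsub>L\<^esub> frac b t = frac (a \<otimes> t \<oplus> b \<otimes> s) (s \<otimes> t)"
proof -
  have "congruent2 (frac_rel R M) (frac_rel R M) (\<lambda>(a, s) (b, t). frac (a \<otimes> t \<oplus> b \<otimes> s) (s \<otimes> t))"
    by (rule congruent2I', simp only: split_paired_all prod.case, rule frac_add_cong)
  from UN_equiv_class2[OF equiv_frac_rel equiv_frac_rel this, of "(a, s)" "(b, t)"] assms
  show ?thesis
    unfolding localization_def Let_def
    by (simp add: frac_class_def[symmetric] case_prod_unfold)
qed

lemma frac_one: "\<one>\<^bsub>L\<^esub> = frac \<one> \<one>" and frac_zero: "\<zero>\<^bsub>L\<^esub> = frac \<zero> \<one>"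
  by (simp_all add: localization_def Let_def)

lemma frac_closed: "a \<in> carrier R \<Longrightarrow> s \<in> M \<Longrightarrow> frac a s \<in> carrier L"
  unfolding localization_def Let_def frac_class_def by (simp add: quotientI)

lemma fracE:
  assumes "x \<in> carrier L"
  obtains a s where "a \<in> carrier R" "s \<in> M" "x = frac a s"
  using assms unfolding localization_def Let_def frac_class_def by (auto elim!: quotientE)

lemma cring_L: "cring L"
proof (intro cringI abelian_groupI comm_monoidI)
  fix x y assume "x \<in> carrier L" "y \<in> carrier L"
  then obtain a s b t where x: "a \<in> carrier R" "s \<in> M" "x = frac a s"
    and y: "b \<in> carrier R" "t \<in> M" "y = frac b t" using fracE by metis
  note c = x(1) y(1) x(2)[THEN M_closed] y(2)[THEN M_closed]
  show "x \<oplus>\<^bsub>L\<^esub> y \<in> carrier L" "x \<otimes>\<^bsub>L\<^esub> y \<in> carrier L"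
    using x y c by (simp_all add: frac_add frac_mult frac_closed M_mult)
  have "a \<otimes> t \<oplus> b \<otimes> s = b \<otimes> s \<oplus> a \<otimes> t" "s \<otimes> t = t \<otimes> s" "a \<otimes> b = b \<otimes> a"
    using c a_comm m_comm by simp_all
  then show "x \<oplus>\<^bsub>L\<^esub> y = y \<oplus>\<^bsub>L\<^esub> x" "x \<otimes>\<^bsub>L\<^esub> y = y \<otimes>\<^bsub>L\<^esub> x"
    using x y by (simp_all add: frac_add frac_mult)
  fix z assume "z \<in> carrier L"
  then obtain d r where z: "d \<in> carrier R" "r \<in> M" "z = frac d r" using fracE by metis
  note c' = c z(1) z(2)[THEN M_closed]
  have 1: "(a \<otimes> t \<oplus> b \<otimes> s) \<otimes> r \<oplus> d \<otimes> (s \<otimes> t) = a \<otimes> (t \<otimes> r) \<oplus> (b \<otimes> r \<oplus> d \<otimes> t) \<otimes> s"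
    and 2: "s \<otimes> t \<otimes> r = s \<otimes> (t \<otimes> r)" and 3: "a \<otimes> b \<otimes> d = a \<otimes> (b \<otimes> d)"
    using c' by algebra+
  show "x \<oplus>\<^bsub>L\<^esub> y \<oplus>\<^bsub>L\<^esub> z = x \<oplus>\<^bsub>L\<^esub> (y \<oplus>\<^bsub>L\<^esub> z)"
    unfolding x(3) y(3) z(3) by (simp add: frac_add M_mult c' x(2) y(2) z(2) 1 2)
  show "x \<otimes>\<^bsub>L\<^esub> y \<otimes>\<^bsub>L\<^esub> z = x \<otimes>\<^bsub>L\<^esub> (y \<otimes>\<^bsub>L\<^esub> z)"
    unfolding x(3) y(3) z(3) by (simp add: frac_mult M_mult c' x(2) y(2) z(2) 2 3)
  \<comment> \<open>Unlike associativity, distributivity does not hold numerator by numerator: one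
    side carries an additional factor \<open>r\<close> in the denominator, so the fractions are
    compared by cross-multiplication.\<close>
  have "(a \<otimes> t \<oplus> b \<otimes> s) \<otimes> d \<otimes> (s \<otimes> r \<otimes> (t \<otimes> r)) =
      (a \<otimes> d \<otimes> (t \<otimes> r) \<oplus> b \<otimes> d \<otimes> (s \<otimes> r)) \<otimes> (s \<otimes> t \<otimes> r)"
    using c' by algebra
  then have "frac ((a \<otimes> t \<oplus> b \<otimes> s) \<otimes> d) (s \<otimes> t \<otimes> r) =
      frac (a \<otimes> d \<otimes> (t \<otimes> r) \<oplus> b \<otimes> d \<otimes> (s \<otimes> r)) (s \<otimes> r \<otimes> (t \<otimes> r))"
    by (rule frac_eqI[rotated 4]) (simp_all add: c' x(2) y(2) z(2) M_mult)
  then show "(x \<oplus>\<^bsub>L\<^esub> y) \<otimes>\<^bsub>L\<^esub> z = x \<otimes>\<^bsub>L\<^esub> z \<oplus>\<^bsub>L\<^esub> y \<otimes>\<^bsub>L\<^esub> z"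
    unfolding x(3) y(3) z(3) by (simp add: frac_add frac_mult M_mult c' x(2) y(2) z(2))
next
  show "\<zero>\<^bsub>L\<^esub> \<in> carrier L" "\<one>\<^bsub>L\<^esub> \<in> carrier L"
    by (simp_all add: frac_one frac_zero frac_closed M_one)
  fix x assume "x \<in> carrier L"
  then obtain a s where x: "a \<in> carrier R" "s \<in> M" "x = frac a s" using fracE by metis
  note c = x(1) x(2)[THEN M_closed]
  show "\<zero>\<^bsub>L\<^esub> \<oplus>\<^bsub>L\<^esub> x = x" "\<one>\<^bsub>L\<^esub> \<otimes>\<^bsub>L\<^esub> x = x"
    unfolding x(3) frac_one frac_zero by (simp_all add: frac_add frac_mult c x(2) M_one)
  have "frac (\<ominus> a) s \<oplus>\<^bsub>L\<^esub> x = \<zero>\<^bsub>L\<^esub>"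
  proof -
    have "(\<ominus> a \<otimes> s \<oplus> a \<otimes> s) \<otimes> \<one> = \<zero> \<otimes> (s \<otimes> s)" using c by algebra
    then have "frac (\<ominus> a \<otimes> s \<oplus> a \<otimes> s) (s \<otimes> s) = frac \<zero> \<one>"
      by (rule frac_eqI[rotated 4]) (simp_all add: c x(2) M_mult M_one)
    then show ?thesis unfolding x(3) frac_zero by (simp add: frac_add c x(2))
  qed
  then show "\<exists>y\<in>carrier L. y \<oplus>\<^bsub>L\<^esub> x = \<zero>\<^bsub>L\<^esub>"
    using frac_closed[of "\<ominus> a" s] x c by blast
qed

sublocale L: cring L by (rule cring_L)

text \<open>With one denominator for a pair, a gcd of the numerators gives a gcd of the fractions,
  and a bilinear form is cleared by one factor per vector.\<close>

lemma common_denominator: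
  assumes "x \<in> carrier L" "y \<in> carrier L"
  obtains a b s where "a \<in> carrier R" "b \<in> carrier R" "s \<in> M" "x = frac a s" "y = frac b s"
proof -
  obtain a s where x: "a \<in> carrier R" "s \<in> M" "x = frac a s" using fracE[OF assms(1)] .
  obtain b t where y: "b \<in> carrier R" "t \<in> M" "y = frac b t" using fracE[OF assms(2)] .
  note c = x(1) y(1) x(2)[THEN M_closed] y(2)[THEN M_closed]
  have "a \<otimes> (s \<otimes> t) = (a \<otimes> t) \<otimes> s" "b \<otimes> (s \<otimes> t) = (b \<otimes> s) \<otimes> t" using c by algebra+
  then have "x = frac (a \<otimes> t) (s \<otimes> t)" "y = frac (b \<otimes> s) (s \<otimes> t)"
    unfolding x(3) y(3) by (intro frac_eqI; simp add: c x(2) y(2) M_mult)+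
  then show thesis using that[of "a \<otimes> t" "b \<otimes> s" "s \<otimes> t"] c x(2) y(2) M_mult by simp
qed

lemma frac_one_add: "a \<in> carrier R \<Longrightarrow> b \<in> carrier R \<Longrightarrow> frac (a \<oplus> b) \<one> = frac a \<one> \<oplus>\<^bsub>L\<^esub> frac b \<one>"
  by (simp add: frac_add M_one)

lemma frac_one_mult: "a \<in> carrier R \<Longrightarrow> b \<in> carrier R \<Longrightarrow> frac (a \<otimes> b) \<one> = frac a \<one> \<otimes>\<^bsub>L\<^esub> frac b \<one>"
  by (simp add: frac_mult M_one)

lemma frac_clear_denominator:
  assumes "a \<in> carrier R" "s \<in> M"
  shows "frac a \<one> = frac a s \<otimes>\<^bsub>L\<^esub> frac s \<one>"
proof -
  note c = assms M_closed[OF assms(2)]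
  have "frac (a \<otimes> s) (s \<otimes> \<one>) = frac a \<one>"
    by (intro frac_eqI) (simp_all add: c M_one)
  then show ?thesis by (simp add: frac_mult c M_one)
qed

lemma frac_unimodular:
  assumes "unimodular R {a, b, c}" "a \<in> carrier R" "b \<in> carrier R" "c \<in> carrier R"
  shows "unimodular L {frac a \<one>, frac b \<one>, frac c \<one>}"
proof (rule unimodularI)
  obtain u v w where c1: "u \<in> carrier R" "v \<in> carrier R" "w \<in> carrier R"
    and one: "a \<otimes> u \<oplus> (b \<otimes> v \<oplus> c \<otimes> w) = \<one>" by (rule unimodular_tripleE[OF assms])
  fix P assume P: "primeideal P L" "{frac a \<one>, frac b \<one>, frac c \<one>} \<subseteq> P"
  interpret P: primeideal P L by (rule P(1))
  have "frac a \<one> \<otimes>\<^bsub>L\<^esub> frac u \<one> \<oplus>\<^bsub>L\<^esub> (frac b \<one> \<otimes>\<^bsub>L\<^esub> frac v \<one> \<oplus>\<^bsub>L\<^esub> frac c \<one> \<otimes>\<^bsub>L\<^esub> frac w \<one>) \<in> P"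
    using P(2) c1 frac_closed M_one by (simp add: P.I_r_closed)
  then have "frac (a \<otimes> u \<oplus> (b \<otimes> v \<oplus> c \<otimes> w)) \<one> \<in> P"
    using c1 assms by (simp add: frac_one_add frac_one_mult)
  then show False using P.one_notin unfolding one frac_one by simp
qed

end

locale hermite_localization = hermite_cring + cring_localization
begin

text \<open>The gcd carries the common denominator, while the cofactors come from \<open>R\<close>
  and keep their Bezout relation.\<close>

lemma hermite_L: "hermite_cring L"
proof (intro hermite_cring.intro cring_L hermite_cring_axioms.intro)
  fix x y assume xy: "x \<in> carrier L" "y \<in> carrier L"
  obtain a b s where ab: "a \<in> carrier R" "b \<in> carrier R" "s \<in> M" "x = frac a s" "y = frac b s"
    by (rule common_denominator[OF xy])
  obtain g a' b' u v where g: "g \<in> carrier R" "a' \<in> carrier R" "b' \<in> carrier R"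
    "u \<in> carrier R" "v \<in> carrier R" "a = g \<otimes> a'" "b = g \<otimes> b'" "a' \<otimes> u \<oplus> b' \<otimes> v = \<one>"
    by (rule gcdE[OF ab(1,2)])
  have "x = frac g s \<otimes>\<^bsub>L\<^esub> frac a' \<one>" "y = frac g s \<otimes>\<^bsub>L\<^esub> frac b' \<one>"
    using ab g M_one M_closed by (simp_all add: frac_mult)
  moreover have "frac a' \<one> \<otimes>\<^bsub>L\<^esub> frac u \<one> \<oplus>\<^bsub>L\<^esub> frac b' \<one> \<otimes>\<^bsub>L\<^esub> frac v \<one> = \<one>\<^bsub>L\<^esub>"
    using g by (simp add: frac_one_add[symmetric] frac_one_mult[symmetric] frac_one)
  then have "unimodular L {frac a' \<one>, frac b' \<one>}"
    by (intro L.unimodular_pairI[of _ _ "frac u \<one>" "frac v \<one>"] frac_closed g M_one)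
  ultimately show "\<exists>g\<in>carrier L. \<exists>a'\<in>carrier L. \<exists>b'\<in>carrier L.
      x = g \<otimes>\<^bsub>L\<^esub> a' \<and> y = g \<otimes>\<^bsub>L\<^esub> b' \<and> unimodular L {a', b'}"
    using frac_closed[OF g(1) ab(3)] frac_closed[OF g(2) M_one] frac_closed[OF g(3) M_one]
    by (intro bexI[of _ "frac g s"] bexI[of _ "frac a' \<one>"] bexI[of _ "frac b' \<one>"]) simp_all
qed

text \<open>The factor \<open>m\<close> hidden in an equality of fractions is itself a denominator,
  so it does no harm: the cleared equation still has a stable element on one side, and the
  represented value divides it.\<close>

lemma represents_one_lift:
  assumes S: "\<And>s. s \<in> S \<Longrightarrow> adequate R s" and L: "adequate_range_1 L"
    and c1: "a \<in> carrier R" "b \<in> carrier R" "c \<in> carrier R" and abc: "unimodular R {a, b, c}"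
  shows "represents_one R a \<zero> b c"
proof -
  interpret L: hermite_cring L by (rule hermite_L)
  note c1' = c1[THEN frac_closed, OF M_one]
  have "represents_one L (frac a \<one>) \<zero>\<^bsub>L\<^esub> (frac b \<one>) (frac c \<one>)"
    by (rule L.adequate_range_1_represents_one[OF L c1' frac_unimodular[OF abc c1]])
  then obtain P1 P2 Q1 Q2 where PQ: "P1 \<in> carrier L" "P2 \<in> carrier L" "Q1 \<in> carrier L" "Q2 \<in> carrier L"
    and one: "bform L (frac a \<one>) \<zero>\<^bsub>L\<^esub> (frac b \<one>) (frac c \<one>) P1 P2 Q1 Q2 = \<one>\<^bsub>L\<^esub>"
    unfolding represents_one_def by (elim bexE)
  obtain p1 p2 s where p: "p1 \<in> carrier R" "p2 \<in> carrier R" "s \<in> M" "P1 = frac p1 s" "P2 = frac p2 s"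
    by (rule common_denominator[OF PQ(1,2)])
  obtain q1 q2 t where q: "q1 \<in> carrier R" "q2 \<in> carrier R" "t \<in> M" "Q1 = frac q1 t" "Q2 = frac q2 t"
    by (rule common_denominator[OF PQ(3,4)])
  note st = p(3)[THEN M_closed] q(3)[THEN M_closed]
  note c2 = p(1,2) q(1,2) st
  note c2' = frac_closed[OF st(1) M_one] frac_closed[OF st(2) M_one]
  \<comment> \<open>The form is linear in each vector: scaling \<open>p\<close> by \<open>s\<close>
    and \<open>q\<close> by \<open>t\<close> scales its value by \<open>s t\<close>.\<close>
  have scale: "bform L (frac a \<one>) \<zero>\<^bsub>L\<^esub> (frac b \<one>) (frac c \<one>)
      (P1 \<otimes>\<^bsub>L\<^esub> frac s \<one>) (P2 \<otimes>\<^bsub>L\<^esub> frac s \<one>) (Q1 \<otimes>\<^bsub>L\<^esub> frac t \<one>) (Q2 \<otimes>\<^bsub>L\<^esub> frac t \<one>) =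
      bform L (frac a \<one>) \<zero>\<^bsub>L\<^esub> (frac b \<one>) (frac c \<one>) P1 P2 Q1 Q2 \<otimes>\<^bsub>L\<^esub> frac s \<one> \<otimes>\<^bsub>L\<^esub> frac t \<one>"
    using PQ c1' c2' unfolding bform_def by algebra
  have "frac (bform R a \<zero> b c p1 p2 q1 q2) \<one> =
      bform L (frac a \<one>) \<zero>\<^bsub>L\<^esub> (frac b \<one>) (frac c \<one>) (frac p1 \<one>) (frac p2 \<one>) (frac q1 \<one>) (frac q2 \<one>)"
    unfolding bform_def frac_zero
    by (simp only: frac_one_add frac_one_mult m_closed a_closed zero_closed c1 c2)
  also have "\<dots> = bform L (frac a \<one>) \<zero>\<^bsub>L\<^esub> (frac b \<one>) (frac c \<one>)
      (P1 \<otimes>\<^bsub>L\<^esub> frac s \<one>) (P2 \<otimes>\<^bsub>L\<^esub> frac s \<one>) (Q1 \<otimes>\<^bsub>L\<^esub> frac t \<one>) (Q2 \<otimes>\<^bsub>L\<^esub> frac t \<one>)"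
    unfolding p(4,5) q(4,5)
    by (simp only: frac_clear_denominator[OF p(1,3)] frac_clear_denominator[OF p(2,3)]
        frac_clear_denominator[OF q(1,3)] frac_clear_denominator[OF q(2,3)])
  also have "\<dots> = frac (s \<otimes> t) \<one>"
    unfolding scale one using c2' st by (simp add: frac_one_mult)
  finally obtain m where m: "m \<in> M" "m \<otimes> (bform R a \<zero> b c p1 p2 q1 q2 \<otimes> \<one>) = m \<otimes> (s \<otimes> t \<otimes> \<one>)"
    using frac_eq_iff[of "bform R a \<zero> b c p1 p2 q1 q2" "s \<otimes> t" \<one> \<one>] c1 c2 M_one bform_closed by auto
  note mc = m(1)[THEN M_closed]
  \<comment> \<open>The numerators \<open>p1\<close>, \<open>p2\<close> need not be coprime in
    \<open>R\<close>; their gcd moves into the cofactor of the represented value.\<close>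
  obtain g r1 r2 where g: "g \<in> carrier R" "r1 \<in> carrier R" "r2 \<in> carrier R"
    "p1 = g \<otimes> r1" "p2 = g \<otimes> r2" "unimodular R {r1, r2}" by (rule gcdE[OF p(1,2)])
  have "bform R a \<zero> b c r1 r2 q1 q2 \<otimes> (m \<otimes> g) = m \<otimes> (bform R a \<zero> b c p1 p2 q1 q2 \<otimes> \<one>)"
    using c1 g(1-3) q(1,2) mc unfolding bform_def g(4,5) by algebra
  also have "\<dots> = m \<otimes> (s \<otimes> t)" using m(2) st by simp
  finally have eq: "m \<otimes> (s \<otimes> t) = bform R a \<zero> b c r1 r2 q1 q2 \<otimes> (m \<otimes> g)" by simp
  have "stable R (m \<otimes> (s \<otimes> t))"
    using mult_closure_stable[of S "m \<otimes> (s \<otimes> t)"] S M_mult[OF m(1) M_mult[OF p(3) q(3)]] by simp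
  then have "stable R (bform R a \<zero> b c r1 r2 q1 q2)"
    by (rule stable_factor[OF _ _ _ eq]) (simp_all add: c1 g q mc)
  moreover have "unimodular R {a, \<zero>, b, c}"
    using abc unfolding unimodular_def by auto
  ultimately show ?thesis
    using represents_one_if_stable[of a \<zero> b c r1 r2 q1 q2] c1 g q by simp
qed

end

section \<open>Diagonal reduction by unimodular row and column operations\<close>

text \<open>Matrices are functions on all pairs of indices here,
  so that index sets can vary in the inductions.\<close>

definition flip :: "(nat \<Rightarrow> nat \<Rightarrow> 'a) \<Rightarrow> nat \<Rightarrow> nat \<Rightarrow> 'a" where
  "flip A = (\<lambda>i j. A j i)"

lemma flip_apply [simp]: "flip A i j = A j i"
  by (simp add: flip_def)

lemma flip_flip [simp]: "flip (flip A) = A"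
  by (simp add: flip_def)

context cring
begin

abbreviation entries_closed :: "(nat \<Rightarrow> nat \<Rightarrow> 'a) \<Rightarrow> bool" where
  "entries_closed A \<equiv> \<forall>r s. A r s \<in> carrier R"

definition row_op :: "nat \<Rightarrow> nat \<Rightarrow> 'a \<Rightarrow> 'a \<Rightarrow> 'a \<Rightarrow> 'a \<Rightarrow> (nat \<Rightarrow> nat \<Rightarrow> 'a) \<Rightarrow> nat \<Rightarrow> nat \<Rightarrow> 'a" where
  "row_op i j x y u v A = (\<lambda>k l. if k = i then x \<otimes> A i l \<oplus> y \<otimes> A j l
     else if k = j then u \<otimes> A i l \<oplus> v \<otimes> A j l else A k l)"

text \<open>The steps are two-line operations of determinant 1 instead of single additions, so that
  one Bezout relation is one step. The sets \<open>I\<close> and \<open>J\<close> bound the rows and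
  columns that may change, which keeps finished parts of the matrix under control.\<close>

inductive reach :: "nat set \<Rightarrow> nat set \<Rightarrow> (nat \<Rightarrow> nat \<Rightarrow> 'a) \<Rightarrow> (nat \<Rightarrow> nat \<Rightarrow> 'a) \<Rightarrow> bool" for I J A where
  refl: "reach I J A A"
| row: "\<lbrakk>reach I J A B; i \<in> I; j \<in> I; i \<noteq> j; x \<in> carrier R; y \<in> carrier R; u \<in> carrier R; v \<in> carrier R;
    x \<otimes> v \<ominus> y \<otimes> u = \<one>\<rbrakk> \<Longrightarrow> reach I J A (row_op i j x y u v B)"
| col: "\<lbrakk>reach I J A B; i \<in> J; j \<in> J; i \<noteq> j; x \<in> carrier R; y \<in> carrier R; u \<in> carrier R; v \<in> carrier R;
    x \<otimes> v \<ominus> y \<otimes> u = \<one>\<rbrakk> \<Longrightarrow> reach I J A (flip (row_op i j x y u v (flip B)))"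

lemma reach_trans:
  assumes "reach I J A B" "reach I J B C"
  shows "reach I J A C"
  using assms(2,1) by induction (auto intro: reach.intros)

lemma reach_flip:
  assumes "reach I J A B"
  shows "reach J I (flip A) (flip B)"
  using assms
proof induction
  case (row B i j x y u v)
  then show ?case using reach.col[OF row.IH row.hyps(2-)] by (simp only: flip_flip)
next
  case (col B i j x y u v)
  then show ?case using reach.row[OF col.IH col.hyps(2-)] by (simp only: flip_flip)
qed (rule reach.refl)

lemma reach_mono:
  assumes "reach I J A B" "I \<subseteq> I'" "J \<subseteq> J'"
  shows "reach I' J' A B"
  using assms
proof induction
  case (row B i j x y u v)
  then show ?case by (intro reach.row) auto
next
  case (col B i j x y u v)
  then show ?case by (intro reach.col) auto
qed (rule reach.refl)

lemma row_op_closed: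
  assumes "entries_closed B" "x \<in> carrier R" "y \<in> carrier R" "u \<in> carrier R" "v \<in> carrier R"
  shows "entries_closed (row_op i j x y u v B)"
  using assms by (simp add: row_op_def)

lemma reach_closed:
  assumes "reach I J A B" "entries_closed A"
  shows "entries_closed B"
  using assms
proof induction
  case (row B i j x y u v)
  then show ?case using row_op_closed by blast
next
  case (col B i j x y u v)
  then have "entries_closed (row_op i j x y u v (flip B))" by (intro row_op_closed) auto
  then show ?case by simp
qed

lemma divides_lincomb:
  assumes "d divides a" "d divides b" "d \<in> carrier R" "x \<in> carrier R" "y \<in> carrier R"
  shows "d divides (x \<otimes> a \<oplus> y \<otimes> b)"
proof -
  obtain a' b' where c: "a' \<in> carrier R" "a = d \<otimes> a'" "b' \<in> carrier R" "b = d \<otimes> b'"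
    using assms(1,2) by (elim dividesE)
  have "x \<otimes> (d \<otimes> a') \<oplus> y \<otimes> (d \<otimes> b') = d \<otimes> (x \<otimes> a' \<oplus> y \<otimes> b')"
    using c(1,3) assms(3-5) by algebra
  then show ?thesis unfolding c(2,4) using c(1,3) assms(3-5) by (intro dividesI) simp_all
qed

text \<open>Operations inside the block \<open>K\<close> times \<open>L\<close> replace its entries
  by linear combinations of its entries, and operations outside leave it alone. The alternatives for
  \<open>I\<close> and \<open>J\<close> exclude mixing with foreign rows or columns.\<close>

lemma reach_divides:
  assumes "reach I J A B" "d \<in> carrier R" "I \<subseteq> K \<or> I \<inter> K = {}" "J \<subseteq> L \<or> J \<inter> L = {}"
    and "\<And>r s. r \<in> K \<Longrightarrow> s \<in> L \<Longrightarrow> d divides A r s" "r \<in> K" "s \<in> L"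
  shows "d divides B r s"
  using assms
proof (induction arbitrary: r s)
  case (row B i j x y u v)
  have IH: "d divides B r s" if "r \<in> K" "s \<in> L" for r s
    using row.IH row.prems that by blast
  show ?case
  proof (cases "I \<subseteq> K")
    case True
    then have "d divides B i s" "d divides B j s" "d divides B r s" using IH row by auto
    then show ?thesis using row divides_lincomb by (simp add: row_op_def)
  next
    case False
    then show ?thesis using row IH by (auto simp: row_op_def)
  qed
next
  case (col B i j x y u v)
  have IH: "d divides B r s" if "r \<in> K" "s \<in> L" for r s
    using col.IH col.prems that by blast
  show ?case
  proof (cases "J \<subseteq> L")
    case True
    then have "d divides B r i" "d divides B r j" "d divides B r s" using IH col by auto
    then show ?thesis using col divides_lincomb by (simp add: row_op_def)
  next
    case False
    then show ?thesis using col IH by (auto simp: row_op_def)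
  qed
qed blast

lemma zero_divides_iff: "\<zero> divides a \<longleftrightarrow> a = \<zero>" if "a \<in> carrier R"
  using that by (auto simp: factor_def)

text \<open>Vanishing is divisibility by \<open>\<zero>\<close>, so this is an instance of
  \<open>reach_divides\<close>.\<close>

lemma reach_zero:
  assumes "reach I J A B" "entries_closed A" "I \<subseteq> K \<or> I \<inter> K = {}" "J \<subseteq> L \<or> J \<inter> L = {}"
    and "\<And>r s. r \<in> K \<Longrightarrow> s \<in> L \<Longrightarrow> A r s = \<zero>" "r \<in> K" "s \<in> L"
  shows "B r s = \<zero>"
proof -
  have "\<zero> divides B r s"
    by (rule reach_divides[OF assms(1) zero_closed assms(3,4) _ assms(6,7)])
      (simp add: assms(5) zero_divides_iff)
  then show ?thesis using zero_divides_iff reach_closed[OF assms(1,2)] by simp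
qed

lemma reach_unchanged:
  assumes "reach I J A B" "r \<notin> I" "s \<notin> J"
  shows "B r s = A r s"
  using assms by induction (auto simp: row_op_def)

text \<open>Each column of \<open>F\<close> is altered by a multiple of column \<open>k\<close>,
  which stays fixed; so the quotients computed from \<open>A\<close> remain valid throughout the
  induction.\<close>

lemma reach_clear_row:
  assumes A: "entries_closed A" and div: "\<And>s. s \<in> L \<Longrightarrow> A k k divides A k s"
    and k: "k \<in> L" and F: "finite F" "F \<subseteq> L - {k}"
  shows "\<exists>B. reach {} L A B \<and> (\<forall>s\<in>F. B k s = \<zero>) \<and> (\<forall>r s. s \<notin> F \<longrightarrow> B r s = A r s)"
  using F
proof (induction F rule: finite_induct)
  case empty
  then show ?case using reach.refl by auto
next
  case (insert j F)
  then obtain B where B: "reach {} L A B" "\<forall>s\<in>F. B k s = \<zero>" "\<forall>r s. s \<notin> F \<longrightarrow> B r s = A r s" by auto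
  obtain q where q: "q \<in> carrier R" "A k j = A k k \<otimes> q"
    using div[of j] insert.prems by (auto elim: dividesE)
  define C where "C = flip (row_op k j \<one> \<zero> (\<ominus> q) \<one> (flip B))"
  have Bc: "entries_closed B" using reach_closed[OF B(1) A] .
  have Bk: "B k k = A k k" "B k j = A k j" using B(3) insert.prems insert.hyps by auto
  have "reach {} L A C" unfolding C_def
    using insert.prems k q by (intro reach.col B(1)) (auto simp: minus_eq)
  moreover have C1: "C r k = B r k" for r using Bc by (simp add: C_def row_op_def)
  moreover have C2: "C r s = B r s" if "s \<noteq> k" "s \<noteq> j" for r s using that by (simp add: C_def row_op_def)
  moreover have C3: "C k j = \<zero>"
  proof -
    have "C k j = \<ominus> q \<otimes> A k k \<oplus> A k k \<otimes> q"
      using insert.prems q A by (auto simp: C_def row_op_def Bk)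
    also have "\<dots> = \<zero>" using q(1) A[rule_format, of k k] by algebra
    finally show ?thesis .
  qed
  moreover have "C k s = \<zero>" if "s \<in> insert j F" for s
    using that C2[of s k] C3 B(2) insert.prems by (cases "s = j") auto
  moreover have "C r s = A r s" if "s \<notin> insert j F" for r s
    using that C1[of r] C2[of s r] B(3) by (cases "s = k") auto
  ultimately show ?case by blast
qed

end

section \<open>Collecting gcds and forming pivots\<close>

context hermite_cring
begin

text \<open>The Bezout coefficients of the entries in columns \<open>j\<close> and \<open>i\<close>
  form a determinant 1 operation putting their gcd into column \<open>j\<close> and zero into column
  \<open>i\<close>. The columns cleared earlier are not touched.\<close>

lemma reach_hermite_row:
  assumes A: "entries_closed A" and j: "j \<in> L" and F: "finite F" "F \<subseteq> L - {j}"
  shows "\<exists>B. reach {} L A B \<and> (\<forall>s\<in>F. B r s = \<zero>)"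
  using F
proof (induction F rule: finite_induct)
  case empty
  then show ?case using reach.refl by auto
next
  case (insert i F)
  then obtain B where B: "reach {} L A B" "\<forall>s\<in>F. B r s = \<zero>" by auto
  have Bc: "entries_closed B" using reach_closed[OF B(1) A] .
  obtain g a b u v where g: "g \<in> carrier R" "a \<in> carrier R" "b \<in> carrier R" "u \<in> carrier R" "v \<in> carrier R"
    "B r j = g \<otimes> a" "B r i = g \<otimes> b" "a \<otimes> u \<oplus> b \<otimes> v = \<one>" by (rule gcdE[OF Bc[rule_format] Bc[rule_format]])
  define C where "C = flip (row_op j i u v (\<ominus> b) a (flip B))"
  have "u \<otimes> a \<ominus> v \<otimes> (\<ominus> b) = a \<otimes> u \<oplus> b \<otimes> v" using g(1-5) by algebra
  then have "reach {} L A C" unfolding C_def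
    using insert.prems j g by (intro reach.col B(1)) auto
  moreover have "C r s = \<zero>" if "s \<in> F" for s
    using that insert.prems insert.hyps B(2) by (auto simp: C_def row_op_def)
  moreover have "C r i = \<zero>"
  proof -
    have "C r i = \<ominus> b \<otimes> (g \<otimes> a) \<oplus> a \<otimes> (g \<otimes> b)"
      using insert.prems g by (auto simp: C_def row_op_def)
    also have "\<dots> = \<zero>" using g(1-3) by algebra
    finally show ?thesis .
  qed
  ultimately show ?case by auto
qed

end

context represents_cring
begin

text \<open>Row \<open>i\<close> is first compressed to the columns \<open>k\<close> and
  \<open>j\<close>; then \<open>represents_gcd\<close> applies to rows \<open>k\<close>,
  \<open>i\<close> and columns \<open>k\<close>, \<open>j\<close>. The new pivot divides the old
  one, hence the rows in \<open>I\<close>, and row \<open>i\<close> has only zeros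
  elsewhere.\<close>

lemma reach_extend_row:
  assumes A: "entries_closed A" and k: "k \<in> I" "k \<in> L" and i: "i \<notin> I" and L: "finite L"
    and div: "\<And>r s. r \<in> I \<Longrightarrow> s \<in> L \<Longrightarrow> A k k divides A r s"
  shows "\<exists>B. reach (insert i I) L A B \<and> (\<forall>r\<in>insert i I. \<forall>s\<in>L. B k k divides B r s)"
\<comment> \<open>With a single column there is no second column for a 2 by 2 block, and the gcd of
  two entries suffices.\<close>
proof (cases "L = {k}")
  case True
  obtain g a b u v where g: "g \<in> carrier R" "a \<in> carrier R" "b \<in> carrier R" "u \<in> carrier R" "v \<in> carrier R"
    "A k k = g \<otimes> a" "A i k = g \<otimes> b" "a \<otimes> u \<oplus> b \<otimes> v = \<one>" by (rule gcdE[OF A[rule_format] A[rule_format]])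
  define B where "B = row_op k i u v (\<ominus> b) a A"
  have ki: "k \<noteq> i" using k i by auto
  have "u \<otimes> a \<ominus> v \<otimes> (\<ominus> b) = a \<otimes> u \<oplus> b \<otimes> v" using g(1-5) by algebra
  then have "reach (insert i I) L A B" unfolding B_def
    using k ki g by (intro reach.row reach.refl) auto
  moreover have "B k k divides B r k" if "r \<in> insert i I" for r
  proof -
    have "g divides A k k" using g by (auto intro: dividesI)
    then have *: "g divides A r k" if "r \<in> insert i I" for r
      using that g div[of r k] True divides_trans[of g "A k k" "A r k"] by (auto intro: dividesI)
    have "B k k = u \<otimes> (g \<otimes> a) \<oplus> v \<otimes> (g \<otimes> b)" using g by (simp add: B_def row_op_def)
    also have "\<dots> = g \<otimes> (a \<otimes> u \<oplus> b \<otimes> v)" using g(1-5) by algebra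
    finally have "B k k = g" using g by simp
    moreover have "g divides B r k"
      using reach_divides[OF \<open>reach (insert i I) L A B\<close> g(1), of "insert i I" L r k] * that True by auto
    ultimately show ?thesis by simp
  qed
  ultimately show ?thesis using True by auto
next
  case False
  then obtain j where j: "j \<in> L" "j \<noteq> k" using k by auto
  \<comment> \<open>Column \<open>k\<close> is left out of these operations, so the pivot is
    preserved.\<close>
  obtain A' where A': "reach {} (L - {k}) A A'" "\<forall>s\<in>L - {k} - {j}. A' i s = \<zero>"
    using reach_hermite_row[OF A, of j "L - {k}" "L - {k} - {j}" i] j L by auto
  have c: "entries_closed A'" using reach_closed[OF A'(1) A] .
  have A'kk: "A' k k = A k k" using reach_unchanged[OF A'(1)] by auto
  obtain p1 p2 q1 q2 where pq: "p1 \<in> carrier R" "p2 \<in> carrier R" "q1 \<in> carrier R" "q2 \<in> carrier R"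
    "unimodular R {p1, p2}" "unimodular R {q1, q2}"
    "\<forall>x\<in>{A' k k, A' k j, A' i k, A' i j}. bform R (A' k k) (A' k j) (A' i k) (A' i j) p1 p2 q1 q2 divides x"
    using represents_gcd[OF c[rule_format] c[rule_format] c[rule_format] c[rule_format],
        of k k k j i k i j]
    by (elim bexE conjE) simp
  define e where "e = bform R (A' k k) (A' k j) (A' i k) (A' i j) p1 p2 q1 q2"
  have e: "e \<in> carrier R" using c pq by (simp add: e_def)
  note ediv = pq(7)[folded e_def]
  obtain s t where st: "s \<in> carrier R" "t \<in> carrier R" "p1 \<otimes> s \<oplus> p2 \<otimes> t = \<one>"
    by (rule unimodular_pairE[OF pq(5,1,2)])
  obtain s' t' where st': "s' \<in> carrier R" "t' \<in> carrier R" "q1 \<otimes> s' \<oplus> q2 \<otimes> t' = \<one>"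
    by (rule unimodular_pairE[OF pq(6,3,4)])
  have ki: "k \<noteq> i" using k i by auto
  \<comment> \<open>Completing \<open>p\<close> and \<open>q\<close> to determinant 1 operations
    places the value of the form at position \<open>(k, k)\<close>.\<close>
  define B where "B = row_op k i p1 p2 (\<ominus> t) s A'"
  define C where "C = flip (row_op k j q1 q2 (\<ominus> t') s' (flip B))"
  have "p1 \<otimes> s \<ominus> p2 \<otimes> (\<ominus> t) = p1 \<otimes> s \<oplus> p2 \<otimes> t" using pq st by algebra
  then have "reach (insert i I) L A' B" unfolding B_def
    using k ki pq st by (intro reach.row reach.refl) auto
  moreover have "q1 \<otimes> s' \<ominus> q2 \<otimes> (\<ominus> t') = q1 \<otimes> s' \<oplus> q2 \<otimes> t'" using pq st' by algebra
  ultimately have A'C: "reach (insert i I) L A' C" unfolding C_def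
    using k j pq st' by (intro reach.col) auto
  have "C k k = q1 \<otimes> (p1 \<otimes> A' k k \<oplus> p2 \<otimes> A' i k) \<oplus> q2 \<otimes> (p1 \<otimes> A' k j \<oplus> p2 \<otimes> A' i j)"
    by (simp add: C_def B_def row_op_def)
  also have "\<dots> = e" unfolding e_def bform_def
    using pq c[rule_format, of k k] c[rule_format, of k j]
      c[rule_format, of i k] c[rule_format, of i j] by algebra
  finally have Ckk: "C k k = e" .
  have "A k k divides A' r s" if "r \<in> I" "s \<in> L" for r s
    using reach_divides[OF A'(1) A[rule_format], of I L k k r s] that div by auto
  then have "e divides A' r s" if "r \<in> I" "s \<in> L" for r s
    using divides_trans[of e "A k k" "A' r s"] that e ediv A'kk by auto
  moreover have "e divides A' i s" if "s \<in> L" for s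
  proof (cases "s \<in> {k, j}")
    case True
    then show ?thesis using ediv by auto
  next
    case False
    then have "A' i s = \<zero>" using A'(2) that by auto
    then show ?thesis using e by (auto intro: dividesI[of "\<zero>"])
  qed
  ultimately have "e divides A' r s" if "r \<in> insert i I" "s \<in> L" for r s
    using that by auto
  then have "e divides C r s" if "r \<in> insert i I" "s \<in> L" for r s
    using reach_divides[OF A'C e, of "insert i I" L r s] that by auto
  moreover have "reach (insert i I) L A C"
    using reach_trans[OF reach_mono[OF A'(1)] A'C] by auto
  ultimately show ?thesis using Ckk by auto
qed

text \<open>Row \<open>k\<close> alone is settled by the Hermite property; the other rows join one
  at a time.\<close>

lemma reach_pivot:
  assumes A: "entries_closed A" and k: "k \<in> L" and L: "finite L" and I: "finite I"
  shows "\<exists>B. reach (insert k I) L A B \<and> (\<forall>r\<in>insert k I. \<forall>s\<in>L. B k k divides B r s)"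
  using I
proof (induction I rule: finite_induct)
  case empty
  obtain B where B: "reach {} L A B" "\<forall>s\<in>L - {k}. B k s = \<zero>"
    using reach_hermite_row[OF A k, of "L - {k}" k] L by auto
  have "B k k divides B k s" if "s \<in> L" for s
    using B(2) that reach_closed[OF B(1) A]
    by (cases "s = k") (auto intro: dividesI[of "\<zero>"])
  then show ?case using reach_mono[OF B(1), of "{k}" L] by auto
next
  case (insert i I)
  then obtain B where B: "reach (insert k I) L A B" "\<forall>r\<in>insert k I. \<forall>s\<in>L. B k k divides B r s" by auto
  show ?case
  proof (cases "i = k")
    case True
    then show ?thesis using B by auto
  next
    case False
    have "entries_closed B" using reach_closed[OF B(1) A] .
    from reach_extend_row[OF this, of k "insert k I" L i] False insert.hyps k L B(2)
    obtain C where "reach (insert i (insert k I)) L B C"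
      "\<forall>r\<in>insert i (insert k I). \<forall>s\<in>L. C k k divides C r s" by auto
    then show ?thesis
      using reach_trans[OF reach_mono[OF B(1), of "insert i (insert k I)" L]]
      by (auto simp: insert_commute)
  qed
qed

lemma reach_block:
  assumes A: "entries_closed A" and k: "k \<in> I" "k \<in> L" and fin: "finite I" "finite L"
  shows "\<exists>B. reach I L A B \<and> (\<forall>r\<in>I. \<forall>s\<in>L. B k k divides B r s) \<and>
    (\<forall>s\<in>L - {k}. B k s = \<zero>) \<and> (\<forall>r\<in>I - {k}. B r k = \<zero>)"
proof -
  have kI: "insert k I = I" using k by auto
  obtain B where B: "reach I L A B" "\<And>r s. r \<in> I \<Longrightarrow> s \<in> L \<Longrightarrow> B k k divides B r s"
    using reach_pivot[OF A k(2) fin(2,1)] unfolding kI by auto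
  have Bc: "entries_closed B" using reach_closed[OF B(1) A] .
  obtain C where C: "reach {} L B C" "\<forall>s\<in>L - {k}. C k s = \<zero>" "\<forall>r s. s \<notin> L - {k} \<longrightarrow> C r s = B r s"
    using reach_clear_row[OF Bc B(2)[OF k(1)] k(2), of "L - {k}"] fin by auto
  have Cc: "entries_closed C" using reach_closed[OF C(1) Bc] .
  have Cd: "C k k divides C r s" if "r \<in> I" "s \<in> L" for r s
    using reach_divides[OF C(1) Cc[rule_format], of I L k k r s] B(2) C(3) that by auto
  \<comment> \<open>The column is cleared by clearing a row of the transpose. Row \<open>k\<close>
    of \<open>C\<close> is unaffected, so its zeros and the pivot survive.\<close>
  obtain D where D: "reach {} I (flip C) D" "\<forall>s\<in>I - {k}. D k s = \<zero>"
    "\<forall>r s. s \<notin> I - {k} \<longrightarrow> D r s = flip C r s"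
    using reach_clear_row[of "flip C" I k "I - {k}"] Cc Cd k fin by auto
  have E: "reach I {} C (flip D)" using reach_flip[OF D(1)] by (simp only: flip_flip)
  have "flip D k k divides flip D r s" if "r \<in> I" "s \<in> L" for r s
    using reach_divides[OF E Cc[rule_format], of I L k k r s] Cd D(3) that by auto
  moreover have "reach I L A (flip D)"
    using reach_trans[OF B(1) reach_trans[OF reach_mono[OF C(1), of I L] reach_mono[OF E, of I L]]]
    by auto
  ultimately show ?thesis using C(2) D(2,3) by (intro exI[of _ "flip D"]) simp
qed

text \<open>Each pivot divides its entire block. Later operations stay inside the smaller block and
  preserve this, so the pivot divides the next one; this is the source of the divisibility
  chain.\<close>

lemma reach_diagonal:
  assumes "entries_closed A"
  shows "\<exists>B. reach {k..<m} {k..<n} A B \<and> (\<forall>r\<in>{k..<m}. \<forall>s\<in>{k..<n}. r \<noteq> s \<longrightarrow> B r s = \<zero>) \<and>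
    (\<forall>i\<ge>k. Suc i < min m n \<longrightarrow> B i i divides B (Suc i) (Suc i))"
  using assms
proof (induction "m - k" arbitrary: k A)
  case 0
  then show ?case by (intro exI[of _ A]) (auto intro: reach.refl)
next
  case (Suc d)
  show ?case
  proof (cases "k < n")
    case False
    then show ?thesis by (intro exI[of _ A]) (auto intro: reach.refl)
  next
    case True
    have km: "k < m" using Suc.hyps(2) by simp
    obtain B where B: "reach {k..<m} {k..<n} A B"
      "\<forall>r\<in>{k..<m}. \<forall>s\<in>{k..<n}. B k k divides B r s"
      "\<forall>s\<in>{k..<n} - {k}. B k s = \<zero>" "\<forall>r\<in>{k..<m} - {k}. B r k = \<zero>"
      using reach_block[OF Suc.prems, of k "{k..<m}" "{k..<n}"] True km by auto
    have Bc: "entries_closed B" using reach_closed[OF B(1) Suc.prems] .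
    have "d = m - Suc k" using Suc.hyps(2) by simp
    from Suc.hyps(1)[OF this Bc] obtain C where C: "reach {Suc k..<m} {Suc k..<n} B C"
      "\<forall>r\<in>{Suc k..<m}. \<forall>s\<in>{Suc k..<n}. r \<noteq> s \<longrightarrow> C r s = \<zero>"
      "\<forall>i\<ge>Suc k. Suc i < min m n \<longrightarrow> C i i divides C (Suc i) (Suc i)" by blast
    have Ckk: "C k k = B k k" using reach_unchanged[OF C(1)] by auto
    \<comment> \<open>Row \<open>k\<close> lies outside the remaining row indices, so column
      operations only mix its zeros.\<close>
    have row: "C k s = \<zero>" if "s \<in> {Suc k..<n}" for s
      using reach_zero[OF C(1) Bc, of "{k}" "{Suc k..<n}" k s] B(3) that by auto
    have col: "C r k = \<zero>" if "r \<in> {Suc k..<m}" for r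
      using reach_zero[OF C(1) Bc, of "{Suc k..<m}" "{k}" r k] B(4) that by auto
    have div: "C k k divides C (Suc k) (Suc k)" if "Suc k < min m n"
      unfolding Ckk
      by (rule reach_divides[OF C(1) Bc[rule_format], of "{Suc k..<m}" "{Suc k..<n}"])
        (use B(2) that in auto)
    have "reach {k..<m} {k..<n} A C"
      by (rule reach_trans[OF B(1) reach_mono[OF C(1)]]) auto
    moreover have "C r s = \<zero>" if "r \<in> {k..<m}" "s \<in> {k..<n}" "r \<noteq> s" for r s
      using row[of s] col[of r] C(2) that by (cases "r = k"; cases "s = k") auto
    moreover have "C i i divides C (Suc i) (Suc i)" if "i \<ge> k" "Suc i < min m n" for i
      using div C(3) that by (cases "i = k") auto
    ultimately show ?thesis by blast
  qed
qed

end

section \<open>Matrices with entries in the carrier\<close>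

definition fmat :: "nat \<Rightarrow> nat \<Rightarrow> (nat \<Rightarrow> nat \<Rightarrow> 'a) \<Rightarrow> 'a mat" where
  "fmat m n A = mat m n (\<lambda>(i, j). A i j)"

lemma fmat_dim [simp]: "dim_row (fmat m n A) = m" "dim_col (fmat m n A) = n"
  by (simp_all add: fmat_def)

lemma fmat_index [simp]: "i < m \<Longrightarrow> j < n \<Longrightarrow> fmat m n A $$ (i, j) = A i j"
  by (simp add: fmat_def)

lemma fmat_cong: "(\<And>i j. i < m \<Longrightarrow> j < n \<Longrightarrow> A i j = B i j) \<Longrightarrow> fmat m n A = fmat m n B"
  by (rule eq_matI) auto

lemma matrices_iff:
  "A \<in> matrices R m n \<longleftrightarrow> dim_row A = m \<and> dim_col A = n \<and> (\<forall>i<m. \<forall>j<n. A $$ (i, j) \<in> carrier R)"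
  by (auto simp: matrices_def elements_mat_def UN_subset_iff image_subset_iff atLeast0LessThan)

context cring
begin

text \<open>Only the inner dimension is recorded, so identities such as associativity hold for all
  outer indices, and bounds matter only in the return to \<open>'a mat\<close>.\<close>

definition mprod :: "nat \<Rightarrow> (nat \<Rightarrow> nat \<Rightarrow> 'a) \<Rightarrow> (nat \<Rightarrow> nat \<Rightarrow> 'a) \<Rightarrow> nat \<Rightarrow> nat \<Rightarrow> 'a" where
  "mprod k A B = (\<lambda>i j. \<Oplus>h\<in>{..<k}. A i h \<otimes> B h j)"

definition unit_mat :: "nat \<Rightarrow> nat \<Rightarrow> 'a" where
  "unit_mat i j = (if i = j then \<one> else \<zero>)"

lemma unit_mat_closed: "entries_closed unit_mat"
  by (simp add: unit_mat_def)

lemma flip_unit_mat [simp]: "flip unit_mat = unit_mat"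
  by (intro ext) (simp add: unit_mat_def)

lemma mone_eq: "mone R n = fmat n n unit_mat"
  by (simp add: mone_def fmat_def unit_mat_def)

lemma fmat_mem: "entries_closed A \<Longrightarrow> fmat m n A \<in> matrices R m n"
  by (simp add: matrices_iff)

lemma matrices_fmatE:
  assumes "A \<in> matrices R m n"
  obtains f where "entries_closed f" "A = fmat m n f"
proof
  \<comment> \<open>Padding with zero makes the function closed on all index pairs.\<close>
  let ?f = "\<lambda>i j. if i < m \<and> j < n then A $$ (i, j) else \<zero>"
  show "entries_closed ?f" using assms by (simp add: matrices_iff)
  show "A = fmat m n ?f" using assms by (intro eq_matI) (auto simp: matrices_iff)
qed

lemma mprod_closed: "entries_closed A \<Longrightarrow> entries_closed B \<Longrightarrow> entries_closed (mprod k A B)"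
  by (simp add: mprod_def Pi_def)

lemma mmult_fmat:
  assumes "entries_closed A" "entries_closed B"
  shows "mmult R (fmat m k A) (fmat k n B) = fmat m n (mprod k A B)"
  using assms unfolding mmult_def
  by (intro eq_matI) (auto simp: mprod_def intro!: finsum_cong')

lemma mmult_closed:
  assumes "A \<in> matrices R m k" "B \<in> matrices R k n"
  shows "mmult R A B \<in> matrices R m n"
proof -
  obtain f where f: "entries_closed f" "A = fmat m k f" using matrices_fmatE[OF assms(1)] .
  obtain g where g: "entries_closed g" "B = fmat k n g" using matrices_fmatE[OF assms(2)] .
  show ?thesis
    unfolding f(2) g(2) mmult_fmat[OF f(1) g(1)] by (rule fmat_mem[OF mprod_closed[OF f(1) g(1)]])
qed

lemma finsum_swap:
  fixes f :: "nat \<Rightarrow> nat \<Rightarrow> 'a"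
  assumes "\<And>i j. f i j \<in> carrier R"
  shows "(\<Oplus>i\<in>{..<k}. \<Oplus>j\<in>{..<l}. f i j) = (\<Oplus>j\<in>{..<l}. \<Oplus>i\<in>{..<k}. f i j)"
proof (induction k)
  case (Suc k)
  have "(\<Oplus>i\<in>{..<Suc k}. \<Oplus>j\<in>{..<l}. f i j) = (\<Oplus>j\<in>{..<l}. f k j) \<oplus> (\<Oplus>j\<in>{..<l}. \<Oplus>i\<in>{..<k}. f i j)"
    using assms Suc by (simp add: lessThan_Suc Pi_def)
  also have "\<dots> = (\<Oplus>j\<in>{..<l}. f k j \<oplus> (\<Oplus>i\<in>{..<k}. f i j))"
    using assms by (subst finsum_addf) (auto simp: Pi_def)
  also have "\<dots> = (\<Oplus>j\<in>{..<l}. \<Oplus>i\<in>{..<Suc k}. f i j)"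
    using assms by (intro finsum_cong') (auto simp: lessThan_Suc Pi_def)
  finally show ?case .
qed (simp add: finsum_zero)

lemma mprod_assoc:
  assumes "entries_closed A" "entries_closed B" "entries_closed C"
  shows "mprod l (mprod k A B) C = mprod k A (mprod l B C)"
proof (intro ext)
  fix i j
  have "mprod l (mprod k A B) C i j = (\<Oplus>s\<in>{..<l}. \<Oplus>r\<in>{..<k}. A i r \<otimes> B r s \<otimes> C s j)"
    unfolding mprod_def using assms by (intro finsum_cong') (auto simp: finsum_ldistr Pi_def)
  also have "\<dots> = (\<Oplus>r\<in>{..<k}. \<Oplus>s\<in>{..<l}. A i r \<otimes> B r s \<otimes> C s j)"
    using assms by (intro finsum_swap) simp
  also have "\<dots> = mprod k A (mprod l B C) i j"
    unfolding mprod_def using assms by (intro finsum_cong') (auto simp: finsum_rdistr Pi_def m_assoc)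
  finally show "mprod l (mprod k A B) C i j = mprod k A (mprod l B C) i j" .
qed

lemma mmult_assoc:
  assumes "A \<in> matrices R m k" "B \<in> matrices R k l" "C \<in> matrices R l n"
  shows "mmult R (mmult R A B) C = mmult R A (mmult R B C)"
proof -
  obtain f where f: "entries_closed f" "A = fmat m k f" using matrices_fmatE[OF assms(1)] .
  obtain g where g: "entries_closed g" "B = fmat k l g" using matrices_fmatE[OF assms(2)] .
  obtain h where h: "entries_closed h" "C = fmat l n h" using matrices_fmatE[OF assms(3)] .
  note fg = mprod_closed[OF f(1) g(1)] and gh = mprod_closed[OF g(1) h(1)]
  show ?thesis
    unfolding f(2) g(2) h(2) mmult_fmat[OF f(1) g(1)] mmult_fmat[OF g(1) h(1)]
      mmult_fmat[OF fg h(1)] mmult_fmat[OF f(1) gh] mprod_assoc[OF f(1) g(1) h(1)] ..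
qed

lemma mprod_unit_mat:
  assumes "entries_closed A" "i < k"
  shows "mprod k unit_mat A i j = A i j"
proof -
  have "mprod k unit_mat A i j = (\<Oplus>h\<in>{..<k}. if i = h then A h j else \<zero>)"
    unfolding mprod_def unit_mat_def using assms(1) by (intro finsum_cong') auto
  also have "\<dots> = A i j"
    using assms by (intro finsum_singleton) auto
  finally show ?thesis .
qed

lemma flip_mprod:
  assumes "entries_closed A" "entries_closed B"
  shows "flip (mprod k A B) = mprod k (flip B) (flip A)"
proof (intro ext)
  fix i j
  show "flip (mprod k A B) i j = mprod k (flip B) (flip A) i j"
    unfolding mprod_def flip_apply using assms by (intro finsum_cong') (auto simp: m_comm)
qed

lemma mprod_unit_mat_right:
  assumes "entries_closed A" "j < k"
  shows "mprod k A unit_mat i j = A i j"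
proof -
  have "mprod k A unit_mat i j = flip (mprod k A unit_mat) j i" by simp
  also have "\<dots> = mprod k unit_mat (flip A) j i"
    using flip_mprod[OF assms(1) unit_mat_closed] by simp
  also have "\<dots> = A i j" using mprod_unit_mat[of "flip A" j k i] assms by simp
  finally show ?thesis .
qed

lemma mmult_mone:
  assumes "A \<in> matrices R m n"
  shows "mmult R (mone R m) A = A" "mmult R A (mone R n) = A"
proof -
  obtain f where f: "entries_closed f" "A = fmat m n f" using matrices_fmatE[OF assms(1)] .
  show "mmult R (mone R m) A = A" "mmult R A (mone R n) = A"
    unfolding f(2) mone_eq mmult_fmat[OF unit_mat_closed f(1)] mmult_fmat[OF f(1) unit_mat_closed]
    by (intro fmat_cong mprod_unit_mat mprod_unit_mat_right f(1); assumption)+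
qed

section \<open>Invertible matrices, and operations as multiplication by them\<close>

lemma GL_mone: "mone R n \<in> GL R n"
proof -
  have "mone R n \<in> matrices R n n" unfolding mone_eq by (rule fmat_mem[OF unit_mat_closed])
  then show ?thesis unfolding GL_def using mmult_mone by blast
qed

lemma GL_mmult:
  assumes "P \<in> GL R n" "Q \<in> GL R n"
  shows "mmult R P Q \<in> GL R n"
proof -
  obtain P' where P: "P \<in> matrices R n n" "P' \<in> matrices R n n"
    "mmult R P P' = mone R n" "mmult R P' P = mone R n"
    using assms(1) unfolding GL_def by blast
  obtain Q' where Q: "Q \<in> matrices R n n" "Q' \<in> matrices R n n"
    "mmult R Q Q' = mone R n" "mmult R Q' Q = mone R n"
    using assms(2) unfolding GL_def by blast
  have inv: "mmult R (mmult R A B) (mmult R B' A') = mone R n"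
    if "A \<in> matrices R n n" "A' \<in> matrices R n n" "B \<in> matrices R n n" "B' \<in> matrices R n n"
      "mmult R A A' = mone R n" "mmult R B B' = mone R n" for A A' B B'
  proof -
    have "mmult R (mmult R A B) (mmult R B' A') = mmult R A (mmult R (mmult R B B') A')"
      using that(1-4) by (simp add: mmult_assoc[of _ n n _ n _ n] mmult_closed[of _ n n _ n])
    then show ?thesis using that mmult_mone by simp
  qed
  show ?thesis unfolding GL_def
    using inv[OF P(1,2) Q(1,2) P(3) Q(3)] inv[OF Q(2,1) P(2,1) Q(4) P(4)]
      mmult_closed[OF P(1) Q(1)] mmult_closed[OF Q(2) P(2)] by blast
qed

text \<open>A row operation acts on the left factor only; with the unit matrix as that factor it
  becomes a left multiplication.\<close>

lemma mprod_row_op: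
  assumes "entries_closed A" "entries_closed B"
    "x \<in> carrier R" "y \<in> carrier R" "u \<in> carrier R" "v \<in> carrier R"
  shows "mprod k (row_op i j x y u v A) B = row_op i j x y u v (mprod k A B)"
proof -
  have lin: "(\<Oplus>h\<in>{..<k}. (x \<otimes> A i h \<oplus> y \<otimes> A j h) \<otimes> B h s) =
      x \<otimes> (\<Oplus>h\<in>{..<k}. A i h \<otimes> B h s) \<oplus> y \<otimes> (\<Oplus>h\<in>{..<k}. A j h \<otimes> B h s)"
    if "x \<in> carrier R" "y \<in> carrier R" for x y s
  proof -
    have "(\<Oplus>h\<in>{..<k}. (x \<otimes> A i h \<oplus> y \<otimes> A j h) \<otimes> B h s) =
        (\<Oplus>h\<in>{..<k}. x \<otimes> (A i h \<otimes> B h s) \<oplus> y \<otimes> (A j h \<otimes> B h s))"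
      using assms that by (intro finsum_cong') (auto simp: l_distr m_assoc)
    also have "\<dots> = (\<Oplus>h\<in>{..<k}. x \<otimes> (A i h \<otimes> B h s)) \<oplus> (\<Oplus>h\<in>{..<k}. y \<otimes> (A j h \<otimes> B h s))"
      using assms that by (intro finsum_addf) auto
    finally show ?thesis using assms that by (simp add: finsum_rdistr Pi_def)
  qed
  show ?thesis
    unfolding mprod_def row_op_def
    by (intro ext) (simp add: lin[OF assms(3,4)] lin[OF assms(5,6)])
qed

definition row_op_mat :: "nat \<Rightarrow> nat \<Rightarrow> 'a \<Rightarrow> 'a \<Rightarrow> 'a \<Rightarrow> 'a \<Rightarrow> nat \<Rightarrow> nat \<Rightarrow> 'a" where
  "row_op_mat i j x y u v = row_op i j x y u v unit_mat"

lemma row_op_mat_closed: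
  assumes "x \<in> carrier R" "y \<in> carrier R" "u \<in> carrier R" "v \<in> carrier R"
  shows "entries_closed (row_op_mat i j x y u v)"
  unfolding row_op_mat_def by (rule row_op_closed[OF unit_mat_closed assms])

lemma mprod_row_op_mat:
  assumes B: "entries_closed B" and c: "x \<in> carrier R" "y \<in> carrier R" "u \<in> carrier R" "v \<in> carrier R"
    and ij: "i < m" "j < m" and r: "r < m"
  shows "mprod m (row_op_mat i j x y u v) B r s = row_op i j x y u v B r s"
  unfolding row_op_mat_def mprod_row_op[OF unit_mat_closed B c]
  using mprod_unit_mat[OF B] ij r by (simp add: row_op_def)

text \<open>The inverse coefficients are the adjugate of the determinant 1 block.\<close>

lemma row_op_inverse:
  assumes "entries_closed A" and c: "x \<in> carrier R" "y \<in> carrier R" "u \<in> carrier R" "v \<in> carrier R"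
    and det: "x \<otimes> v \<ominus> y \<otimes> u = \<one>" and "i \<noteq> j"
  shows "row_op i j v (\<ominus> y) (\<ominus> u) x (row_op i j x y u v A) r s = A r s"
proof -
  have 1: "v \<otimes> (x \<otimes> a \<oplus> y \<otimes> b) \<oplus> \<ominus> y \<otimes> (u \<otimes> a \<oplus> v \<otimes> b) = a"
    "\<ominus> u \<otimes> (x \<otimes> a \<oplus> y \<otimes> b) \<oplus> x \<otimes> (u \<otimes> a \<oplus> v \<otimes> b) = b"
    if "a \<in> carrier R" "b \<in> carrier R" for a b
  proof -
    have "v \<otimes> (x \<otimes> a \<oplus> y \<otimes> b) \<oplus> \<ominus> y \<otimes> (u \<otimes> a \<oplus> v \<otimes> b) = (x \<otimes> v \<ominus> y \<otimes> u) \<otimes> a"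
      "\<ominus> u \<otimes> (x \<otimes> a \<oplus> y \<otimes> b) \<oplus> x \<otimes> (u \<otimes> a \<oplus> v \<otimes> b) = (x \<otimes> v \<ominus> y \<otimes> u) \<otimes> b"
      using c that by algebra+
    then show "v \<otimes> (x \<otimes> a \<oplus> y \<otimes> b) \<oplus> \<ominus> y \<otimes> (u \<otimes> a \<oplus> v \<otimes> b) = a"
      "\<ominus> u \<otimes> (x \<otimes> a \<oplus> y \<otimes> b) \<oplus> x \<otimes> (u \<otimes> a \<oplus> v \<otimes> b) = b" using det that by simp_all
  qed
  show ?thesis using assms(1,7) 1[of "A i s" "A j s"] by (auto simp: row_op_def)
qed

lemma row_op_mat_inverse:
  assumes c: "x \<in> carrier R" "y \<in> carrier R" "u \<in> carrier R" "v \<in> carrier R"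
    and det: "x \<otimes> v \<ominus> y \<otimes> u = \<one>" and ij: "i < n" "j < n" "i \<noteq> j" and r: "r < n"
  shows "mprod n (row_op_mat i j v (\<ominus> y) (\<ominus> u) x) (row_op_mat i j x y u v) r s = unit_mat r s"
proof -
  have "mprod n (row_op_mat i j v (\<ominus> y) (\<ominus> u) x) (row_op_mat i j x y u v) r s =
      row_op i j v (\<ominus> y) (\<ominus> u) x (row_op_mat i j x y u v) r s"
    by (rule mprod_row_op_mat[OF row_op_mat_closed[OF c]]) (simp_all add: c ij r)
  also have "\<dots> = unit_mat r s"
    unfolding row_op_mat_def by (rule row_op_inverse[OF unit_mat_closed c det ij(3)])
  finally show ?thesis .
qed

lemma row_op_mat_GL:
  assumes c: "x \<in> carrier R" "y \<in> carrier R" "u \<in> carrier R" "v \<in> carrier R"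
    and det: "x \<otimes> v \<ominus> y \<otimes> u = \<one>" and ij: "i < n" "j < n" "i \<noteq> j"
  shows "fmat n n (row_op_mat i j x y u v) \<in> GL R n"
    and "fmat n n (flip (row_op_mat i j x y u v)) \<in> GL R n"
proof -
  let ?E = "row_op_mat i j x y u v" and ?F = "row_op_mat i j v (\<ominus> y) (\<ominus> u) x"
  have E: "entries_closed ?E" and F: "entries_closed ?F"
    using c by (simp_all add: row_op_mat_closed)
  then have E': "entries_closed (flip ?E)" and F': "entries_closed (flip ?F)" by simp_all
  have FE: "mprod n ?F ?E r s = unit_mat r s" if "r < n" for r s
    by (rule row_op_mat_inverse[OF c det ij that])
  \<comment> \<open>The inverse operation has determinant 1 as well and its adjugate is the original
    one, so the same lemma gives the other one-sided inverse.\<close>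
  have det': "v \<otimes> x \<ominus> \<ominus> y \<otimes> \<ominus> u = \<one>"
  proof -
    have "v \<otimes> x \<ominus> \<ominus> y \<otimes> \<ominus> u = x \<otimes> v \<ominus> y \<otimes> u" using c by algebra
    then show ?thesis using det by simp
  qed
  have EF: "mprod n ?E ?F r s = unit_mat r s" if "r < n" for r s
    using row_op_mat_inverse[OF c(4) _ _ c(1) det' ij that, of s] c by simp
  have "mmult R (fmat n n ?E) (fmat n n ?F) = mone R n" "mmult R (fmat n n ?F) (fmat n n ?E) = mone R n"
    unfolding mmult_fmat[OF E F] mmult_fmat[OF F E] mone_eq by (intro fmat_cong EF FE; assumption)+
  then show "fmat n n ?E \<in> GL R n"
    unfolding GL_def using fmat_mem[OF E] fmat_mem[OF F] by blast
  \<comment> \<open>Transposition reverses products, so the bound moves from the row index to the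
    column index.\<close>
  have "mprod n (flip ?E) (flip ?F) r s = unit_mat r s" "mprod n (flip ?F) (flip ?E) r s = unit_mat r s"
    if "s < n" for r s
    using FE[OF that, of r] EF[OF that, of r] flip_mprod[OF F E, symmetric] flip_mprod[OF E F, symmetric]
    by (simp_all add: unit_mat_def)
  then have "mmult R (fmat n n (flip ?E)) (fmat n n (flip ?F)) = mone R n"
    "mmult R (fmat n n (flip ?F)) (fmat n n (flip ?E)) = mone R n"
    unfolding mmult_fmat[OF E' F'] mmult_fmat[OF F' E'] mone_eq by (intro fmat_cong; simp)+
  then show "fmat n n (flip ?E) \<in> GL R n"
    unfolding GL_def using fmat_mem[OF E'] fmat_mem[OF F'] by blast
qed

text \<open>Row operations accumulate in \<open>P\<close> on the left, column operations in
  \<open>Q\<close> on the right.\<close>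

lemma reach_GL:
  assumes "reach {0..<m} {0..<n} A B" "entries_closed A"
  shows "\<exists>P\<in>GL R m. \<exists>Q\<in>GL R n. fmat m n B = mmult R (mmult R P (fmat m n A)) Q"
  using assms
proof induction
  case refl
  note A = fmat_mem[OF refl, of m n]
  have "fmat m n A = mmult R (mmult R (mone R m) (fmat m n A)) (mone R n)"
    using mmult_mone[OF A] by simp
  then show ?case using GL_mone by blast
next
  case (row B i j x y u v)
  then obtain P Q where PQ: "P \<in> GL R m" "Q \<in> GL R n" "fmat m n B = mmult R (mmult R P (fmat m n A)) Q"
    by auto
  have M: "P \<in> matrices R m m" "Q \<in> matrices R n n" using PQ unfolding GL_def by auto
  have Bc: "entries_closed B" by (rule reach_closed[OF row.hyps(1) row.prems])
  let ?E = "row_op_mat i j x y u v"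
  have ij: "i < m" "j < m" using row.hyps by auto
  have E: "fmat m m ?E \<in> GL R m" by (rule row_op_mat_GL(1)) (use row.hyps ij in auto)
  then have EM: "fmat m m ?E \<in> matrices R m m" unfolding GL_def by auto
  have "fmat m n (row_op i j x y u v B) = mmult R (fmat m m ?E) (fmat m n B)"
    unfolding mmult_fmat[OF row_op_mat_closed[OF row.hyps(5-8)] Bc]
    by (rule fmat_cong) (use mprod_row_op_mat[OF Bc row.hyps(5-8) ij] in simp)
  also have "\<dots> = mmult R (mmult R (mmult R (fmat m m ?E) P) (fmat m n A)) Q"
    unfolding PQ(3) using M EM fmat_mem[OF row.prems, of m n]
    by (simp add: mmult_assoc[of _ m m _ m _ n] mmult_assoc[of _ m m _ n _ n]
        mmult_closed[of _ m m _ m] mmult_closed[of _ m m _ n])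
  finally show ?case using GL_mmult[OF E PQ(1)] PQ(2) by blast
next
  case (col B i j x y u v)
  then obtain P Q where PQ: "P \<in> GL R m" "Q \<in> GL R n" "fmat m n B = mmult R (mmult R P (fmat m n A)) Q"
    by auto
  have M: "P \<in> matrices R m m" "Q \<in> matrices R n n" using PQ unfolding GL_def by auto
  have Bc: "entries_closed B" by (rule reach_closed[OF col.hyps(1) col.prems])
  then have Bc': "entries_closed (flip B)" by simp
  let ?E = "row_op_mat i j x y u v"
  have ij: "i < n" "j < n" using col.hyps by auto
  have E: "fmat n n (flip ?E) \<in> GL R n" by (rule row_op_mat_GL(2)) (use col.hyps ij in auto)
  then have EM: "fmat n n (flip ?E) \<in> matrices R n n" unfolding GL_def by auto
  have Ec: "entries_closed ?E" by (rule row_op_mat_closed[OF col.hyps(5-8)])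
  then have Ec': "entries_closed (flip ?E)" by simp
  have "mprod n B (flip ?E) r s = flip (row_op i j x y u v (flip B)) r s" if "s < n" for r s
  proof -
    have "mprod n B (flip ?E) = flip (mprod n ?E (flip B))"
      using flip_mprod[OF Ec Bc', of n] by (simp only: flip_flip)
    then show ?thesis using mprod_row_op_mat[of "flip B", OF Bc' col.hyps(5-8) ij that, of r] by simp
  qed
  then have "fmat m n (flip (row_op i j x y u v (flip B))) = mmult R (fmat m n B) (fmat n n (flip ?E))"
    unfolding mmult_fmat[OF Bc Ec'] by (intro fmat_cong) simp
  also have "\<dots> = mmult R (mmult R P (fmat m n A)) (mmult R Q (fmat n n (flip ?E)))"
    unfolding PQ(3) using M EM fmat_mem[OF col.prems, of m n]
    by (simp add: mmult_assoc[of _ m n _ n _ n] mmult_closed[of _ m m _ n])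
  finally show ?case using GL_mmult[OF PQ(2) E] PQ(1) by blast
qed

end

lemma (in represents_cring) elementary_divisor_ring: "elementary_divisor_ring R"
  unfolding elementary_divisor_ring_def
proof (intro allI ballI)
  fix m n A assume A: "A \<in> matrices R m n"
  obtain f where f: "entries_closed f" "A = fmat m n f" using matrices_fmatE[OF A] .
  obtain g where g: "reach {0..<m} {0..<n} f g"
    "\<forall>r\<in>{0..<m}. \<forall>s\<in>{0..<n}. r \<noteq> s \<longrightarrow> g r s = \<zero>"
    "\<forall>i\<ge>0. Suc i < min m n \<longrightarrow> g i i divides g (Suc i) (Suc i)"
    using reach_diagonal[OF f(1), of 0 m n] by (elim exE conjE)
  obtain P Q where PQ: "P \<in> GL R m" "Q \<in> GL R n" "fmat m n g = mmult R (mmult R P A) Q"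
    using reach_GL[OF g(1) f(1)] unfolding f(2)[symmetric] by (elim bexE)
  have dim: "dim_row A = m" "dim_col A = n" using f(2) by simp_all
  show "admits_diagonal_reduction R A"
    unfolding admits_diagonal_reduction_def Let_def dim
  proof (intro bexI[OF _ PQ(1)] bexI[OF _ PQ(2)] conjI allI impI)
    show "mmult R (mmult R P A) Q $$ (i, j) = \<zero>" if "i < m" "j < n" "i \<noteq> j" for i j
      unfolding PQ(3)[symmetric] using g(2) that by simp
    show "mmult R (mmult R P A) Q $$ (i, i) divides mmult R (mmult R P A) Q $$ (Suc i, Suc i)"
      if "Suc i < min m n" for i
      unfolding PQ(3)[symmetric] using g(3) that by simp
  qed
qed

section \<open>Hermite rings and elementary divisor rings\<close>

context cring
begin

lemma row_matrix_mem:
  assumes "a \<in> carrier R" "b \<in> carrier R"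
  shows "mat_of_rows_list 2 [[a, b]] \<in> matrices R 1 2"
  using assms by (auto simp: matrices_iff mat_of_rows_list_def less_2_cases_iff)

lemma row_matrix_index:
  "mat_of_rows_list 2 [[a, b]] $$ (0, 0) = a" "mat_of_rows_list 2 [[a, b]] $$ (0, Suc 0) = b"
  by (simp_all add: mat_of_rows_list_def)

lemma mmult_index_2:
  assumes "A \<in> matrices R m 2" "B \<in> matrices R 2 n" "i < m" "j < n"
  shows "mmult R A B $$ (i, j) = A $$ (i, 0) \<otimes> B $$ (0, j) \<oplus> A $$ (i, 1) \<otimes> B $$ (1, j)"
proof -
  have "{..<2} = {0, 1 :: nat}" by auto
  then show ?thesis using assms by (simp add: mmult_def matrices_iff)
qed

lemma mmult_index_1:
  assumes "A \<in> matrices R m 1" "B \<in> matrices R 1 n" "i < m" "j < n"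
  shows "mmult R A B $$ (i, j) = A $$ (i, 0) \<otimes> B $$ (0, j)"
proof -
  have "{..<1} = {0 :: nat}" by auto
  then show ?thesis using assms by (simp add: mmult_def matrices_iff)
qed

text \<open>Inverting \<open>Q\<close> gives \<open>(a, b) = (c, 0) Q'\<close>: the common divisor
  is \<open>c\<close>, the cofactors are the first row of \<open>Q'\<close>, and that row is
  unimodular because \<open>Q' Q\<close> has 1 in its corner.\<close>

lemma hermite_ring_imp_hermite_cring:
  assumes "hermite_ring R"
  shows "hermite_cring R"
proof
  fix a b assume ab: "a \<in> carrier R" "b \<in> carrier R"
  let ?A = "mat_of_rows_list 2 [[a, b]]"
  obtain Q c where Q: "Q \<in> GL R 2" and c: "c \<in> carrier R"
    and QA: "mmult R ?A Q = mat_of_rows_list 2 [[c, \<zero>]]"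
    using assms ab unfolding hermite_ring_def by blast
  obtain Q' where Q': "Q \<in> matrices R 2 2" "Q' \<in> matrices R 2 2"
    "mmult R Q Q' = mone R 2" "mmult R Q' Q = mone R 2"
    using Q unfolding GL_def by blast
  note A = row_matrix_mem[OF ab]
  have [simp]: "Q $$ (i, j) \<in> carrier R" "Q' $$ (i, j) \<in> carrier R" if "i < 2" "j < 2" for i j
    using Q' that by (auto simp: matrices_iff)
  have "?A = mmult R (mat_of_rows_list 2 [[c, \<zero>]]) Q'"
    using mmult_assoc[OF A Q'(1,2)] mmult_mone[OF A] QA Q'(3) by simp
  then have eq: "?A $$ (0, j) = c \<otimes> Q' $$ (0, j)" if "j < 2" for j
    using mmult_index_2[OF row_matrix_mem[OF c zero_closed] Q'(2), of 0 j] that c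
    by (simp add: row_matrix_index)
  have "Q' $$ (0, 0) \<otimes> Q $$ (0, 0) \<oplus> Q' $$ (0, 1) \<otimes> Q $$ (1, 0) = \<one>"
    using mmult_index_2[OF Q'(2,1), of 0 0] Q'(4) by (simp add: mone_def)
  then have "unimodular R {Q' $$ (0, 0), Q' $$ (0, 1)}"
    by (intro unimodular_pairI[of _ _ "Q $$ (0, 0)" "Q $$ (1, 0)"]) simp_all
  then show "\<exists>g\<in>carrier R. \<exists>a'\<in>carrier R. \<exists>b'\<in>carrier R. a = g \<otimes> a' \<and> b = g \<otimes> b' \<and> unimodular R {a', b'}"
    using eq[of 0] eq[of 1] c
    by (intro bexI[of _ c] bexI[of _ "Q' $$ (0, 0)"] bexI[of _ "Q' $$ (0, 1)"])
      (simp_all add: row_matrix_index)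
qed

text \<open>Diagonal reduction of the row \<open>(a, b)\<close> gives \<open>P A Q\<close> with
  second entry zero, where \<open>P\<close> is an invertible 1 by 1 matrix; cancelling it leaves
  \<open>A Q\<close> of the required form.\<close>

lemma elementary_divisor_ring_imp_hermite_ring:
  assumes "elementary_divisor_ring R"
  shows "hermite_ring R"
  unfolding hermite_ring_def
proof (intro ballI)
  fix a b assume ab: "a \<in> carrier R" "b \<in> carrier R"
  let ?A = "mat_of_rows_list 2 [[a, b]]"
  note A = row_matrix_mem[OF ab]
  have dim: "dim_row ?A = 1" "dim_col ?A = 2" using A by (simp_all add: matrices_iff)
  have "admits_diagonal_reduction R ?A"
    using assms A unfolding elementary_divisor_ring_def by blast
  then obtain P Q where PQ: "P \<in> GL R 1" "Q \<in> GL R 2" "mmult R (mmult R P ?A) Q $$ (0, 1) = \<zero>"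
    unfolding admits_diagonal_reduction_def Let_def dim by auto
  obtain P' where P: "P \<in> matrices R 1 1" "P' \<in> matrices R 1 1" "mmult R P' P = mone R 1"
    using PQ(1) unfolding GL_def by blast
  have Q: "Q \<in> matrices R 2 2" using PQ(2) unfolding GL_def by blast
  have AQ: "mmult R ?A Q \<in> matrices R 1 2" by (rule mmult_closed[OF A Q])
  have D: "mmult R P (mmult R ?A Q) \<in> matrices R 1 2" by (rule mmult_closed[OF P(1) AQ])
  have "mmult R ?A Q = mmult R P' (mmult R P (mmult R ?A Q))"
    using mmult_assoc[OF P(2,1) AQ] mmult_mone[OF AQ] P(3) by simp
  then have "mmult R ?A Q $$ (0, 1) = P' $$ (0, 0) \<otimes> mmult R P (mmult R ?A Q) $$ (0, 1)"
    using mmult_index_1[OF P(2) D, of 0 1] by simp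
  also have "\<dots> = \<zero>"
    using PQ(3) mmult_assoc[OF P(1) A Q] P(2) by (simp add: matrices_iff)
  finally have 0: "mmult R ?A Q $$ (0, 1) = \<zero>" .
  have "mmult R ?A Q = mat_of_rows_list 2 [[mmult R ?A Q $$ (0, 0), \<zero>]]"
    using AQ 0 by (intro eq_matI) (auto simp: matrices_iff mat_of_rows_list_def less_2_cases_iff)
  moreover have "mmult R ?A Q $$ (0, 0) \<in> carrier R" using AQ by (simp add: matrices_iff)
  ultimately show "\<exists>Q\<in>GL R 2. \<exists>c\<in>carrier R. mmult R ?A Q = mat_of_rows_list 2 [[c, \<zero>]]"
    using PQ(2) by blast
qed

end

theorem theorem4p5:
  fixes R :: "('a, 'm) ring_scheme" and S :: "'a set"
  assumes "cring R"
    and "S = {a \<in> carrier R. adequate R a}"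
    and "adequate_range_1 (localization R S)"
  shows "elementary_divisor_ring R \<longleftrightarrow> hermite_ring R"
proof
  assume "elementary_divisor_ring R"
  then show "hermite_ring R" by (rule cring.elementary_divisor_ring_imp_hermite_ring[OF assms(1)])
next
  assume "hermite_ring R"
  then have "hermite_cring R" by (rule cring.hermite_ring_imp_hermite_cring[OF assms(1)])
  moreover have "cring_localization R S"
    using assms(1,2) by (intro cring_localization.intro cring_localization_axioms.intro) auto
  ultimately interpret hermite_localization R S by (rule hermite_localization.intro)
  have adequate: "adequate R s" if "s \<in> S" for s using that assms(2) by simp
  have "represents_cring R"
  proof
    fix a b c assume "a \<in> carrier R" "b \<in> carrier R" "c \<in> carrier R" "unimodular R {a, b, c}"
    then show "represents_one R a \<zero>\<^bsub>R\<^esub> b c"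
      by (intro represents_one_lift adequate assms(3))
  qed
  then show "elementary_divisor_ring R" by (rule represents_cring.elementary_divisor_ring)
qed

end
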